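(* Let $\lVert\cdot\rVert_A$ and $\lVert\cdot\rVert_B$ be rearrangement-invariant Banach function norms over $([0,\infty),\lambda)$. Then the Wiener--Luxemburg quasinorm $\lVert\cdot\rVert_{WL(A,B)}$ is equivalent to a rearrangement-invariant Banach function norm. Consequently, the Wiener--Luxemburg amalgam space $WL(A,B)$ is (up to equivalence of the defining functional) a rearrangement-invariant Banach function space.
   Context: $\lambda$ is Lebesgue measure on $[0,\infty)$; $M$ is the set of extended complex-valued $\lambda$-measurable functions on $[0,\infty)$ (identified when equal a.e.), $M_+$ the non-negative ones. The non-increasing rearrangement of $f\in M$ is $f^*(t)=\inf\{s\ge 0:\lambda(\{|f|>s\})\le t\}$. A Banach function norm is a map $\lVert\cdot\rVert:M\to[0,\infty]$ with $\lVert\,|f|\,\rVert=\lVert f\rVert$ whose restriction to $M_+$ satisfies: (P1) it is positively homogeneous, $\lVert f\rVert=0\Leftrightarrow f=0$ a.e., and $\lVert f+g\rVert\le\lVert f\rVert+\lVert g\rVert$; (P2) $f\le g$ a.e. implies $\lVert f\rVert\le\lVert g\rVert$; (P3) $f_n\uparrow f$ a.e. implies $\lVert f_n\rVert\uparrow\lVert f\rVert$; (P4) $\lVert\chi_E\rVert<\infty$ whenever $\lambda(E)<\infty$; (P5) for every $E$ with $\lambda(E)<\infty$ there is a finite $C_E$ with $\int_E f\,d\lambda\le C_E\lVert f\rVert$ for all $f\in M_+$. It is rearrangement-invariant (r.i.) if $f^*=g^*$ implies $\lVert f\rVert=\lVert g\rVert$. The corresponding (r.i.) Banach function space is $\{f\in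 M:\lVert f\rVert<\infty\}$. Two functionals $N_1,N_2:M\to[0,\infty]$ are equivalent if there is $C_0\in(0,\infty)$ with $C_0^{-1}N_1(f)\le N_2(f)\le C_0N_1(f)$ for all $f\in M$. For r.i. Banach function norms $\lVert\cdot\rVert_A,\lVert\cdot\rVert_B$: $\lVert f\rVert_{WL(A,B)}=\lVert f^*\chi_{[0,1]}\rVert_A+\lVert f^*\chi_{(1,\infty)}\rVert_B$ for $f\in M$, and $WL(A,B)=\{f\in M:\lVert f\rVert_{WL(A,B)}<\infty\}$. *)

theory Defs
  imports "HOL-Analysis.Analysis"
begin

section \<open>Extended complex numbers\<close>

datatype ecomplex = Fin complex | Infty

primrec emod :: "ecomplex \<Rightarrow> ennreal" where
  "emod (Fin z) = ennreal (cmod z)"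
| "emod Infty = \<infinity>"

definition ec_of_ennreal :: "ennreal \<Rightarrow> ecomplex" where
  "ec_of_ennreal x = (if x = \<infinity> then Infty else Fin (complex_of_real (enn2real x)))"

text \<open>The Borel \<open>\<sigma>\<close>-algebra of the Riemann sphere; it contains the singleton of \<open>Infty\<close> as the
  complement of \<open>range Fin\<close>.\<close>

definition ec_borel :: "ecomplex measure" where
  "ec_borel = sigma UNIV {Fin ` U | U. open U}"

section \<open>Measurable functions on the half-line\<close>

abbreviation lam :: "real measure" where
  "lam \<equiv> lebesgue_on {0..}"

text \<open>Elements of \<open>M\<close> are represented by functions on all of \<open>real\<close>, whose values on the negative
  half-line are immaterial. Non-negative elements are represented by \<open>ennreal\<close>-valued functions,
  which \<open>emb\<close> regards as elements of \<open>M\<close>.\<close>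

definition Mfun :: "(real \<Rightarrow> ecomplex) set" where
  "Mfun = measurable lam ec_borel"

definition Mpos :: "(real \<Rightarrow> ennreal) set" where
  "Mpos = borel_measurable lam"

definition emb :: "(real \<Rightarrow> ennreal) \<Rightarrow> real \<Rightarrow> ecomplex" where
  "emb f = (\<lambda>x. ec_of_ennreal (f x))"

definition rearr :: "(real \<Rightarrow> ecomplex) \<Rightarrow> real \<Rightarrow> ennreal" where
  "rearr f t = Inf {ennreal s | s. 0 \<le> s \<and> emeasure lam {x \<in> space lam. emod (f x) > ennreal s} \<le> ennreal t}"

lemma emod_ec_of_ennreal [simp]: "emod (ec_of_ennreal x) = x"
  by (cases x) (auto simp: ec_of_ennreal_def)

lemma space_ec_borel [simp]: "space ec_borel = UNIV"
  by (simp add: ec_borel_def)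

lemma sets_ec_borel: "sets ec_borel = {A. Fin -` A \<in> sets borel}"
proof
  have inj: "inj Fin" by (auto intro: injI)
  show "sets ec_borel \<subseteq> {A. Fin -` A \<in> sets borel}"
  proof
    fix A assume "A \<in> sets ec_borel"
    then have "A \<in> sigma_sets UNIV {Fin ` U | U. open U}" by (simp add: ec_borel_def)
    then show "A \<in> {A. Fin -` A \<in> sets borel}"
    proof induction
      case (Basic a) then show ?case by (auto simp: inj_vimage_image_eq[OF inj])
    next
      case (Compl a)
      then have "- (Fin -` a) \<in> sets borel" by simp
      then show ?case by (simp add: vimage_Diff Compl_eq_Diff_UNIV)
    next
      case (Union a) then show ?case by (auto simp: vimage_UN)
    qed simp
  qed
  have meas: "Fin ` B \<in> sets ec_borel" if "B \<in> sets borel" for B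
  proof -
    have "B \<in> sigma_sets UNIV {S. open S}" using that by (simp add: borel_def)
    then show ?thesis
    proof induction
      case (Basic a) then show ?case by (auto simp: ec_borel_def)
    next
      case (Compl a)
      have "Fin ` UNIV \<in> sets ec_borel"
        unfolding ec_borel_def by (auto intro!: sigma_sets.Basic exI[of _ UNIV])
      moreover have "Fin ` (UNIV - a) = Fin ` UNIV - Fin ` a" by auto
      ultimately show ?case using Compl by auto
    next
      case (Union a) then show ?case by (auto simp: image_UN)
    qed simp
  qed
  show "{A. Fin -` A \<in> sets borel} \<subseteq> sets ec_borel"
  proof
    fix A assume "A \<in> {A. Fin -` A \<in> sets borel}"
    then have 1: "Fin ` (Fin -` A) \<in> sets ec_borel" using meas by blast
    have "space ec_borel - range Fin \<in> sets ec_borel" using meas[of UNIV] by (intro sets.compl_sets) simp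
    moreover have "space ec_borel - range Fin = {Infty}" by (auto intro: ecomplex.exhaust)
    ultimately have 2: "{Infty} \<in> sets ec_borel" by simp
    have "A = (if Infty \<in> A then Fin ` (Fin -` A) \<union> {Infty} else Fin ` (Fin -` A))"
      by (auto simp: image_iff) (metis ecomplex.exhaust)+
    then show "A \<in> sets ec_borel" using 1 2 by (metis sets.Un)
  qed
qed

lemma emod_measurable: "emod \<in> borel_measurable ec_borel"
proof (rule measurableI)
  fix A :: "ennreal set" assume "A \<in> sets borel"
  then have "(\<lambda>z. ennreal (cmod z)) -` A \<inter> space borel \<in> sets borel"
    by (intro measurable_sets[of _ _ borel]) auto
  then show "emod -` A \<inter> space ec_borel \<in> sets ec_borel"
    by (simp add: sets_ec_borel vimage_def)
qed simp

lemma ec_of_ennreal_measurable: "ec_of_ennreal \<in> measurable borel ec_borel"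
proof -
  have Fin: "Fin \<in> measurable borel ec_borel"
    by (rule measurableI) (auto simp: sets_ec_borel)
  show ?thesis
    unfolding ec_of_ennreal_def[abs_def]
    by (intro measurable_If measurable_compose[OF _ Fin]) (auto intro: measurable_const)
qed

lemma emod_in_Mpos: "f \<in> Mfun \<Longrightarrow> (\<lambda>x. emod (f x)) \<in> Mpos"
  unfolding Mfun_def Mpos_def by (rule measurable_compose[OF _ emod_measurable])

lemma emb_in_Mfun: "f \<in> Mpos \<Longrightarrow> emb f \<in> Mfun"
  unfolding Mfun_def Mpos_def emb_def by (rule measurable_compose[OF _ ec_of_ennreal_measurable])

section \<open>Banach function norms\<close>

text \<open>Functionals on \<open>M\<close> are total functions, of which only the values on \<open>Mfun\<close> matter. The
  assumption \<open>AE_cong\<close> says that they are well defined on classes modulo equality a.e.\<close>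

locale banach_function_norm =
  fixes N :: "(real \<Rightarrow> ecomplex) \<Rightarrow> ennreal"
  assumes AE_cong: "\<And>f g. \<lbrakk>f \<in> Mfun; g \<in> Mfun; AE x in lam. f x = g x\<rbrakk> \<Longrightarrow> N f = N g"
    and modulus: "\<And>f. f \<in> Mfun \<Longrightarrow> N (emb (\<lambda>x. emod (f x))) = N f"
    and P1_homogeneous: "\<And>f a. \<lbrakk>f \<in> Mpos; 0 \<le> a\<rbrakk> \<Longrightarrow> N (emb (\<lambda>x. ennreal a * f x)) = ennreal a * N (emb f)"
    and P1_zero: "\<And>f. f \<in> Mpos \<Longrightarrow> N (emb f) = 0 \<longleftrightarrow> (AE x in lam. f x = 0)"
    and P1_triangle: "\<And>f g. \<lbrakk>f \<in> Mpos; g \<in> Mpos\<rbrakk> \<Longrightarrow> N (emb (\<lambda>x. f x + g x)) \<le> N (emb f) + N (emb g)"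
    and P2: "\<And>f g. \<lbrakk>f \<in> Mpos; g \<in> Mpos; AE x in lam. f x \<le> g x\<rbrakk> \<Longrightarrow> N (emb f) \<le> N (emb g)"
    and P3: "\<And>F f. \<lbrakk>\<And>n::nat. F n \<in> Mpos; f \<in> Mpos;
              AE x in lam. incseq (\<lambda>n. F n x) \<and> (\<lambda>n. F n x) \<longlonglongrightarrow> f x\<rbrakk>
             \<Longrightarrow> incseq (\<lambda>n. N (emb (F n))) \<and> (\<lambda>n. N (emb (F n))) \<longlonglongrightarrow> N (emb f)"
    and P4: "\<And>E. \<lbrakk>E \<in> sets lam; emeasure lam E < \<infinity>\<rbrakk> \<Longrightarrow> N (emb (indicator E)) < \<infinity>"
    and P5: "\<And>E. \<lbrakk>E \<in> sets lam; emeasure lam E < \<infinity>\<rbrakk>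
             \<Longrightarrow> \<exists>C<\<infinity>. \<forall>f\<in>Mpos. (\<integral>\<^sup>+x\<in>E. f x \<partial>lam) \<le> C * N (emb f)"

locale ri_banach_function_norm = banach_function_norm +
  assumes rearrangement_invariant:
    "\<And>f g. \<lbrakk>f \<in> Mfun; g \<in> Mfun; \<forall>t\<ge>0. rearr f t = rearr g t\<rbrakk> \<Longrightarrow> N f = N g"

definition fspace :: "((real \<Rightarrow> ecomplex) \<Rightarrow> ennreal) \<Rightarrow> (real \<Rightarrow> ecomplex) set" where
  "fspace N = {f \<in> Mfun. N f < \<infinity>}"

definition equivalent_functionals ::
    "((real \<Rightarrow> ecomplex) \<Rightarrow> ennreal) \<Rightarrow> ((real \<Rightarrow> ecomplex) \<Rightarrow> ennreal) \<Rightarrow> bool" where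
  "equivalent_functionals N1 N2 \<longleftrightarrow>
     (\<exists>C::real. 0 < C \<and> (\<forall>f\<in>Mfun. ennreal (inverse C) * N1 f \<le> N2 f \<and> N2 f \<le> ennreal C * N1 f))"

section \<open>Wiener--Luxemburg amalgams\<close>

definition WL_norm ::
    "((real \<Rightarrow> ecomplex) \<Rightarrow> ennreal) \<Rightarrow> ((real \<Rightarrow> ecomplex) \<Rightarrow> ennreal) \<Rightarrow> (real \<Rightarrow> ecomplex) \<Rightarrow> ennreal" where
  "WL_norm A B f =
     A (emb (\<lambda>t. rearr f t * indicator {0..1} t)) + B (emb (\<lambda>t. rearr f t * indicator {1<..} t))"

definition WL_space ::
    "((real \<Rightarrow> ecomplex) \<Rightarrow> ennreal) \<Rightarrow> ((real \<Rightarrow> ecomplex) \<Rightarrow> ennreal) \<Rightarrow> (real \<Rightarrow> ecomplex) set" where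
  "WL_space A B = fspace (WL_norm A B)"

end

theory Submission
  imports Defs
begin

text \<open>
  An equivalent norm is obtained as the sum of a local and a global part, both of which are
  suprema of seminorms, so that the axioms of a Banach function norm are immediate. The local part
  is the supremum of \<open>A\<close> of the restrictions of \<open>f\<close> to sets of measure at most one. The global
  part replaces the paper's \<open>f* \<chi>_(1,\<infinity>)\<close>, which is not subadditive in \<open>f\<close>, by averages: for
  disjoint sets \<open>E_0, \<dots>, E_{m-1}\<close> of measure at most one, take \<open>B\<close> of the step function with
  the value \<open>\<integral>_{E_n} |f|\<close> on \<open>(n+1, n+2]\<close>, and then the supremum over all such families.

  Level sets of a simple function below \<open>u\<close> can be moved greedily, from the highest level down, into
  the superlevel sets of any \<open>v\<close> with a larger distribution function, since Lebesgue measure has no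
  atoms. Hence all these functionals depend only on \<open>f*\<close>, and \<open>f\<close> may be replaced by \<open>f*\<close> in
  the comparison with the amalgam quasinorm. The only non-trivial inequality left is that averaging
  is bounded on \<open>B\<close>: an average is, up to a factor two, a mean of cyclic shifts of one function, all
  of which have the same distribution.
\<close>

subsection \<open>Distribution functions\<close>

lemma sets_lam_iff: "E \<in> sets lam \<longleftrightarrow> E \<subseteq> {0..} \<and> E \<in> sets lebesgue"
  by (subst sets_restrict_space_iff) auto

lemma emeasure_lam: "E \<subseteq> {0..} \<Longrightarrow> emeasure lam E = emeasure lebesgue E"
  by (rule emeasure_restrict_space) auto

lemma interval_in_lam [simp]:
  fixes a b :: real
  assumes "0 \<le> a"
  shows "{a<..b} \<in> sets lam" "{a..b} \<in> sets lam" "{a<..} \<in> sets lam" "{a..<b} \<in> sets lam" "{a..} \<in> sets lam"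
  using assms by (auto simp: sets_lam_iff)

text \<open>Lebesgue measure has no atoms: the measure of \<open>E \<inter> {0..x}\<close> is a
  1-Lipschitz function of \<open>x\<close>, so the intermediate value theorem yields every value
  below the measure of \<open>E\<close>.\<close>

lemma subset_of_emeasure:
  assumes E: "E \<in> sets lam" and m: "m \<le> emeasure lam E" "m < \<infinity>"
  obtains G where "G \<in> sets lam" "G \<subseteq> E" "emeasure lam G = m"
proof (cases "m = emeasure lam E")
  case True
  show ?thesis by (rule that[OF E order_refl True[symmetric]])
next
  case False
  \<comment> \<open>Strictness guarantees that a bounded truncation of \<open>E\<close> already has
    measure above \<open>m\<close>; for unbounded \<open>E\<close> the full measure may be attained
    by no truncation.\<close>
  have lt: "m < emeasure lam E" by (rule order.not_eq_order_implies_strict[OF False m(1)])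
  have "(SUP n. emeasure lam (E \<inter> {0..real n})) = emeasure lam (\<Union>n. E \<inter> {0..real n})"
    using E by (intro SUP_emeasure_incseq) (auto simp: incseq_def)
  moreover have "(\<Union>n. E \<inter> {0..real n}) = E"
    using E real_arch_simple by (auto simp: sets_lam_iff subset_iff)
  ultimately have "m < (SUP n. emeasure lam (E \<inter> {0..real n}))"
    using lt by (simp only:)
  then obtain n where n: "m < emeasure lam (E \<inter> {0..real n})"
    unfolding less_SUP_iff by blast
  define \<phi> where "\<phi> x = measure lam (E \<inter> {0..x})" for x
  have fm: "E \<inter> {0..x} \<in> fmeasurable lam" for x
  proof (rule fmeasurableI)
    have "emeasure lam (E \<inter> {0..x}) \<le> emeasure lam {0..x}"
      using E by (intro emeasure_mono) auto
    also have "\<dots> < \<infinity>" by (simp add: emeasure_lam emeasure_lborel_Icc_eq)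
    finally show "emeasure lam (E \<inter> {0..x}) < \<infinity>" .
  qed (use E in auto)
  have phi: "emeasure lam (E \<inter> {0..x}) = ennreal (\<phi> x)" for x
    using fm[of x] by (simp add: \<phi>_def emeasure_eq_measure2)
  have step: "\<bar>\<phi> y - \<phi> x\<bar> \<le> y - x" if "0 \<le> x" "x \<le> y" for x y
  proof -
    have "\<phi> y \<le> measure lam ((E \<inter> {0..x}) \<union> {x<..y})"
      unfolding \<phi>_def using that E fm[of x]
      by (intro measure_mono_fmeasurable fmeasurable.Un) (auto intro!: fmeasurableI simp: emeasure_lam subset_iff)
    also have "\<dots> \<le> \<phi> x + measure lam {x<..y}"
      unfolding \<phi>_def using that E by (intro measure_Un_le) auto
    also have "measure lam {x<..y} = y - x"
      using that by (simp add: measure_def emeasure_lam subset_iff)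
    finally have "\<phi> y \<le> \<phi> x + (y - x)" .
    moreover have "\<phi> x \<le> \<phi> y"
      unfolding \<phi>_def using that E fm[of y] by (intro measure_mono_fmeasurable) auto
    ultimately show ?thesis by simp
  qed
  have "1-lipschitz_on {0..real n} \<phi>"
  proof (rule lipschitz_onI)
    fix x y assume "x \<in> {0..real n}" "y \<in> {0..real n}"
    then show "dist (\<phi> x) (\<phi> y) \<le> 1 * dist x y"
      using step[of x y] step[of y x] by (cases "x \<le> y") (auto simp: dist_real_def)
  qed simp
  then have cont: "continuous_on {0..real n} \<phi>" by (rule lipschitz_on_continuous_on)
  have "{0::real} \<in> sets lam" by (simp add: sets_lam_iff)
  then have "\<phi> 0 \<le> measure lam {0..0}"
    unfolding \<phi>_def using E by (intro measure_mono_fmeasurable) (auto intro!: fmeasurableI simp: emeasure_lam)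
  also have "\<dots> = 0" by (simp add: measure_def emeasure_lam)
  also have "0 \<le> enn2real m" by simp
  finally have "\<phi> 0 \<le> enn2real m" .
  moreover have "enn2real m \<le> \<phi> (real n)"
    using n m(2) unfolding phi by (cases m) (auto simp: ennreal_less_iff)
  ultimately obtain x where "0 \<le> x" "\<phi> x = enn2real m"
    using IVT'[OF _ _ _ cont] by auto
  then have "emeasure lam (E \<inter> {0..x}) = m"
    using phi[of x] m(2) by simp
  then show ?thesis using that[of "E \<inter> {0..x}"] sets.Int[OF E interval_in_lam(2)[of 0 x]] by auto
qed

definition distr :: "(real \<Rightarrow> ennreal) \<Rightarrow> ennreal \<Rightarrow> ennreal" where
  "distr u s = emeasure lam {x \<in> space lam. s < u x}"

lemma superlevel_in_sets: "u \<in> Mpos \<Longrightarrow> {x \<in> space lam. s < u x} \<in> sets lam"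
  unfolding Mpos_def by measurable

lemma superlevel_in_sets' [simp]: "u \<in> Mpos \<Longrightarrow> {x. 0 \<le> x \<and> s < u x} \<in> sets lam"
  using superlevel_in_sets[of u s] by simp

lemma distr_AE_mono:
  assumes "u \<in> Mpos" "v \<in> Mpos" "AE x in lam. u x \<le> v x"
  shows "distr u s \<le> distr v s"
  unfolding distr_def
proof (rule emeasure_mono_AE)
  show "AE x in lam. x \<in> {x \<in> space lam. s < u x} \<longrightarrow> x \<in> {x \<in> space lam. s < v x}"
    using assms(3) by (auto elim!: AE_mp)
qed (use assms in simp)

text \<open>The superlevel sets at \<open>s + 1 / (n + 1)\<close> increase to the one at
  \<open>s\<close>, so continuity from below applies. Finiteness of \<open>s\<close> puts these
  levels strictly above \<open>s\<close>.\<close>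

lemma distr_right_continuous:
  assumes u: "u \<in> Mpos" and "s < \<infinity>" and lt: "t < distr u s"
  obtains s' where "s < s'" "t < distr u s'"
proof -
  define A where "A n = {x \<in> space lam. s + ennreal (1 / Suc n) < u x}" for n
  have A: "A n \<in> sets lam" for n using u by (simp add: A_def)
  have "incseq A"
  proof (rule incseq_SucI, unfold A_def, safe)
    fix n x assume "s + ennreal (1 / Suc n) < u x"
    moreover have "s + ennreal (1 / Suc (Suc n)) \<le> s + ennreal (1 / Suc n)"
      by (intro add_left_mono ennreal_leI) (simp add: frac_le)
    ultimately show "s + ennreal (1 / Suc (Suc n)) < u x" by (rule le_less_trans[rotated])
  qed
  then have "(SUP n. emeasure lam (A n)) = emeasure lam (\<Union>n. A n)"
    using A by (intro SUP_emeasure_incseq) auto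
  also have "(\<Union>n. A n) = {x \<in> space lam. s < u x}"
  proof safe
    fix x n assume "x \<in> A n"
    have "s \<le> s + ennreal (1 / Suc n)" by simp
    also have "\<dots> < u x" using \<open>x \<in> A n\<close> by (simp add: A_def)
    finally show "s < u x" .
  next
    fix x assume x: "x \<in> space lam" "s < u x"
    have "(\<lambda>n. s + ennreal (1 / Suc n)) \<longlonglongrightarrow> s + ennreal 0"
      using LIMSEQ_Suc[OF lim_1_over_n[where 'a=real]]
      by (intro tendsto_add tendsto_const tendsto_ennrealI) simp
    then have "eventually (\<lambda>n. s + ennreal (1 / Suc n) < u x) sequentially"
      using x by (intro order_tendstoD) auto
    then show "x \<in> (\<Union>n. A n)" using x by (auto simp: A_def eventually_sequentially)
  qed (auto simp: A_def)
  finally obtain n where "t < emeasure lam (A n)"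
    using lt by (metis distr_def less_SUP_iff)
  moreover have "s < s + ennreal (1 / Suc n)"
    using \<open>s < \<infinity>\<close> by (cases s) (auto simp: ennreal_plus[symmetric] ennreal_less_iff simp del: ennreal_plus)
  ultimately show ?thesis using that[of "s + ennreal (1 / Suc n)"] by (simp add: A_def distr_def)
qed

lemma rearr_greater_iff:
  assumes f: "f \<in> Mfun" and "0 \<le> t"
  shows "s < rearr f t \<longleftrightarrow> ennreal t < distr (\<lambda>x. emod (f x)) s"
proof (cases s)
  case top
  then show ?thesis by (simp add: distr_def)
next
  case (real r)
  let ?u = "\<lambda>x. emod (f x)"
  show ?thesis
  proof
    assume *: "s < rearr f t"
    show "ennreal t < distr ?u s"
    proof (rule ccontr)
      assume "\<not> ?thesis"
      then have "rearr f t \<le> s"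
        unfolding rearr_def using real by (intro Inf_lower) (auto simp: distr_def)
      with * show False by simp
    qed
  next
    assume "ennreal t < distr ?u s"
    \<comment> \<open>A level strictly above \<open>s\<close> is needed: \<open>s'\<close> bounds
      the defining infimum from below, whereas \<open>s\<close> itself would only give a weak
      inequality.\<close>
    then obtain s' where s': "s < s'" "ennreal t < distr ?u s'"
      by (rule distr_right_continuous[OF emod_in_Mpos[OF f], rotated]) (use real in auto)
    have "s' \<le> rearr f t"
      unfolding rearr_def
    proof (rule Inf_greatest, safe)
      fix q assume q: "emeasure lam {x \<in> space lam. emod (f x) > ennreal q} \<le> ennreal t"
      show "s' \<le> ennreal q"
      proof (rule ccontr)
        assume "\<not> ?thesis"
        then have "distr ?u s' \<le> distr ?u q"
          unfolding distr_def using emod_in_Mpos[OF f] by (intro emeasure_mono) auto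
        with q s' show False by (auto simp: distr_def)
      qed
    qed
    with s' show "s < rearr f t" by simp
  qed
qed

lemma rearr_in_Mpos:
  assumes "f \<in> Mfun" shows "rearr f \<in> Mpos"
  unfolding Mpos_def
proof (rule borel_measurableI_greater)
  fix s
  have "{t \<in> space lam. s < rearr f t} = {t. 0 \<le> t \<and> ennreal t < distr (\<lambda>x. emod (f x)) s}"
    using rearr_greater_iff[OF assms] by auto
  also have "\<dots> = {0..} \<inter> {t. ennreal t < distr (\<lambda>x. emod (f x)) s}" by auto
  also have "\<dots> \<in> sets lam"
    unfolding sets_lam_iff by (auto intro!: sets.Int borel_measurable_less simp del: sets_completionI_sets)
  finally show "{t \<in> space lam. s < rearr f t} \<in> sets lam" .
qed

text \<open>Equimeasurability: by \<open>rearr_greater_iff\<close> the superlevel set of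
  \<open>rearr f\<close> is an interval starting at 0 whose length is the measure of the superlevel
  set of the modulus of \<open>f\<close>.\<close>

lemma distr_rearr:
  assumes "f \<in> Mfun"
  shows "distr (rearr f) s = distr (\<lambda>x. emod (f x)) s"
proof -
  let ?d = "distr (\<lambda>x. emod (f x)) s"
  have "{t \<in> space lam. s < rearr f t} = {t. 0 \<le> t \<and> ennreal t < ?d}"
    using rearr_greater_iff[OF assms] by auto
  moreover have "{t. 0 \<le> t \<and> ennreal t < ?d} = (if ?d = \<infinity> then {0..} else {0..<enn2real ?d})"
    by (cases ?d) (auto simp: ennreal_less_iff)
  moreover have "emeasure lebesgue {0::real..} = \<infinity>"
  proof (rule ccontr)
    assume "\<not> ?thesis"
    then obtain r where r: "0 \<le> r" "emeasure lebesgue {0::real..} = ennreal r"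
      by (cases "emeasure lebesgue {0::real..}") auto
    have "emeasure lebesgue {0..r + 1} \<le> emeasure lebesgue {0::real..}"
      by (intro emeasure_mono) auto
    with r show False by simp
  qed
  ultimately have "distr (rearr f) s = (if ?d = \<infinity> then \<infinity> else ennreal (enn2real ?d))"
    by (auto simp: distr_def emeasure_lam subset_iff)
  then show ?thesis by (cases ?d) auto
qed

lemma rearr_antimono: "s \<le> t \<Longrightarrow> rearr f t \<le> rearr f s"
  unfolding rearr_def by (rule Inf_superset_mono) (blast intro: order_trans ennreal_leI)

lemma rearr_cong_distr:
  assumes "\<And>s. distr (\<lambda>x. emod (f x)) s = distr (\<lambda>x. emod (g x)) s"
  shows "rearr f = rearr g"
  using assms unfolding rearr_def distr_def by simp

lemma distr_cong_rearr:
  assumes "f \<in> Mfun" "g \<in> Mfun" and eq: "\<forall>t\<ge>0. rearr f t = rearr g t"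
  shows "distr (\<lambda>x. emod (f x)) s = distr (\<lambda>x. emod (g x)) s"
proof -
  have "distr (rearr f) s = distr (rearr g) s"
    unfolding distr_def using eq by (intro arg_cong[where f="emeasure lam"]) auto
  then show ?thesis using assms by (simp add: distr_rearr)
qed

subsection \<open>Transferring simple functions along an inequality of distribution functions\<close>

text \<open>Greedy placement, highest levels first. The pieces placed before \<open>H i\<close> lie
  in the superlevel set of \<open>v\<close> at \<open>c i\<close>, and the last hypothesis says that
  this set has room for \<open>H i\<close> beside them.\<close>

lemma transfer_sets:
  fixes c :: "'i \<Rightarrow> ennreal"
  assumes "finite I" and v: "v \<in> Mpos"
    and "\<And>i. i \<in> I \<Longrightarrow> c i < \<infinity>"
    and "\<And>i. i \<in> I \<Longrightarrow> H i \<in> sets lam \<and> emeasure lam (H i) < \<infinity>"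
    and "disjoint_family_on H I"
    and "\<And>i. i \<in> I \<Longrightarrow> emeasure lam (\<Union>j\<in>{j\<in>I. c i \<le> c j}. H j) \<le> distr v (c i)"
  shows "\<exists>G. (\<forall>i\<in>I. G i \<in> sets lam \<and> emeasure lam (G i) = emeasure lam (H i)
              \<and> (\<forall>x\<in>G i. c i < v x)) \<and> disjoint_family_on G I"
  using \<open>finite I\<close> assms(3-)
\<comment> \<open>Ranking by the negated level makes each inserted index one of lowest level so
  far.\<close>
proof (induction I rule: finite_ranking_induct[where f="\<lambda>i. - enn2real (c i)"])
  case empty
  then show ?case by (auto simp: disjoint_family_on_def)
next
  case (insert i I)
  show ?case
  proof (cases "i \<in> I")
    case True
    then show ?thesis using insert by (simp add: insert_absorb)
  next
    case False
    have le: "c i \<le> c j" if "j \<in> I" for j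
    proof -
      have "enn2real (c i) \<le> enn2real (c j)" using insert(2)[OF that] by simp
      then show ?thesis
        using insert.prems(1)[of i] insert.prems(1)[of j] that
        by (cases "c i"; cases "c j") (auto simp: ennreal_leI)
    qed
    have "\<exists>G. (\<forall>i\<in>I. G i \<in> sets lam \<and> emeasure lam (G i) = emeasure lam (H i)
              \<and> (\<forall>x\<in>G i. c i < v x)) \<and> disjoint_family_on G I"
    proof (rule insert.IH)
      show "disjoint_family_on H I"
        using insert.prems(3) by (auto simp: disjoint_family_on_def)
      fix k assume k: "k \<in> I"
      have "emeasure lam (\<Union>j\<in>{j\<in>I. c k \<le> c j}. H j) \<le> emeasure lam (\<Union>j\<in>{j\<in>insert i I. c k \<le> c j}. H j)"
        using insert.prems(2) insert(1) by (intro emeasure_mono sets.finite_UN) auto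
      also have "\<dots> \<le> distr v (c k)" using insert.prems(4) k by simp
      finally show "emeasure lam (\<Union>j\<in>{j\<in>I. c k \<le> c j}. H j) \<le> distr v (c k)" .
    qed (use insert.prems in auto)
    then obtain G where G: "\<And>j. j \<in> I \<Longrightarrow> G j \<in> sets lam \<and> emeasure lam (G j) = emeasure lam (H j)
              \<and> (\<forall>x\<in>G j. c j < v x)" "disjoint_family_on G I" by blast
    let ?S = "{x \<in> space lam. c i < v x}" and ?U = "\<Union>j\<in>I. G j"
    have Us: "?U \<in> sets lam" using G insert(1) by auto
    have UI: "?U \<subseteq> ?S"
    proof safe
      fix x j assume j: "j \<in> I" "x \<in> G j"
      show "x \<in> space lam" using G(1)[OF j(1)] j(2) by (auto simp: sets_lam_iff)
      show "c i < v x" using G(1)[OF j(1)] j(2) le[OF j(1)] by (blast intro: le_less_trans)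
    qed
    have sumH: "emeasure lam (\<Union>j\<in>J. H j) = (\<Sum>j\<in>J. emeasure lam (H j))" if "J \<subseteq> insert i I" for J
      using that insert.prems insert(1)
      by (intro sum_emeasure[symmetric])
        (auto intro: disjoint_family_on_mono finite_subset[of J "insert i I"])
    have U: "emeasure lam ?U = (\<Sum>j\<in>I. emeasure lam (H j))"
      using G insert(1) by (subst sum_emeasure[symmetric]) auto
    have "{j \<in> insert i I. c i \<le> c j} = insert i I" using le by auto
    then have "emeasure lam (\<Union>j\<in>insert i I. H j) \<le> distr v (c i)"
      using insert.prems(4)[of i] by simp
    then have "emeasure lam (H i) + emeasure lam ?U \<le> emeasure lam ?S"
      using sumH[of "insert i I"] U False insert(1) by (simp add: distr_def)
    also have "\<dots> = emeasure lam (?S - ?U) + emeasure lam ?U"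
      using Us UI v by (subst plus_emeasure) (auto simp: Un_absorb2)
    \<comment> \<open>The measure of \<open>?U\<close> may be cancelled because it is a finite sum
      of finite measures.\<close>
    finally have "emeasure lam (H i) \<le> emeasure lam (?S - ?U)"
      using U insert.prems(2) insert(1)
      by (simp add: add.commute[of _ "emeasure lam ?U"] ennreal_add_left_cancel_le less_top[symmetric])
    then obtain K where K: "K \<in> sets lam" "K \<subseteq> ?S - ?U" "emeasure lam K = emeasure lam (H i)"
      using Us v insert.prems(2)[of i] superlevel_in_sets[OF v]
      by (elim subset_of_emeasure[rotated]) auto
    show ?thesis
      using K G False
      by (intro exI[of _ "G(i := K)"]) (auto simp: disjoint_family_on_def)
  qed
qed

text \<open>The index type is arbitrary so that several sets may carry the same value. Once the
  family is disjoint, \<open>c i\<close> is the value on \<open>G i\<close>.\<close>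

definition step :: "'i set \<Rightarrow> ('i \<Rightarrow> ennreal) \<Rightarrow> ('i \<Rightarrow> real set) \<Rightarrow> real \<Rightarrow> ennreal" where
  "step I c G x = (\<Sum>i\<in>I. c i * indicator (G i) x)"

lemma step_eq:
  assumes "finite I" "disjoint_family_on G I" "i \<in> I" "x \<in> G i"
  shows "step I c G x = c i"
proof -
  have "(\<Sum>j\<in>I - {i}. c j * indicator (G j) x) = 0"
    using assms by (intro sum.neutral) (auto simp: disjoint_family_on_def indicator_def)
  then show ?thesis
    using assms by (simp add: step_def sum.remove)
qed

lemma step_eq_0: "x \<notin> (\<Union>i\<in>I. G i) \<Longrightarrow> step I c G x = 0"
  by (auto simp: step_def intro!: sum.neutral)

lemma step_in_Mpos: "(\<And>i. i \<in> I \<Longrightarrow> G i \<in> sets lam) \<Longrightarrow> step I c G \<in> Mpos"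
  unfolding step_def[abs_def] Mpos_def
  by (intro borel_measurable_sum borel_measurable_times_ennreal borel_measurable_const
      borel_measurable_indicator) auto

text \<open>The superlevel set is the disjoint union of the \<open>G i\<close> whose value exceeds
  the level. Agreement with \<open>step\<close> is asked on the half-line, the only place where a
  simple function on \<open>lam\<close> is known.\<close>

lemma distr_step:
  assumes "finite I" "disjoint_family_on G I" and G: "\<And>i. i \<in> I \<Longrightarrow> G i \<in> sets lam"
    and u: "\<And>x. x \<in> space lam \<Longrightarrow> u x = step I c G x"
  shows "distr u s = (\<Sum>i\<in>{i\<in>I. s < c i}. emeasure lam (G i))"
proof -
  have "{x \<in> space lam. s < u x} = (\<Union>i\<in>{i\<in>I. s < c i}. G i)" (is "?l = ?r")
  proof (intro equalityI subsetI)
    fix x assume x: "x \<in> ?l"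
    then have lt: "s < step I c G x" using u by auto
    show "x \<in> ?r"
    proof (cases "x \<in> (\<Union>i\<in>I. G i)")
      case True
      then obtain i where i: "i \<in> I" "x \<in> G i" by blast
      then show ?thesis using lt step_eq[OF assms(1,2) i] by auto
    next
      case False
      then show ?thesis using lt by (simp add: step_eq_0)
    qed
  next
    fix x assume "x \<in> ?r"
    then obtain i where i: "i \<in> I" "x \<in> G i" "s < c i" by blast
    then have "x \<in> space lam" using G[OF i(1)] by (auto simp: sets_lam_iff)
    then show "x \<in> ?l" using i u step_eq[OF assms(1,2) i(1,2)] by simp
  qed
  moreover have "emeasure lam ?r = (\<Sum>i\<in>{i\<in>I. s < c i}. emeasure lam (G i))"
    using assms by (intro sum_emeasure[symmetric]) (auto simp: disjoint_family_on_def)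
  ultimately show ?thesis by (simp add: distr_def)
qed

lemma set_nn_integral_step:
  assumes "finite I" and G: "\<And>i. i \<in> I \<Longrightarrow> G i \<in> sets lam" and F: "F \<in> sets lam"
    and u: "\<And>x. x \<in> space lam \<Longrightarrow> u x = step I c G x"
  shows "(\<integral>\<^sup>+x\<in>F. u x \<partial>lam) = (\<Sum>i\<in>I. c i * emeasure lam (G i \<inter> F))"
proof -
  have "(\<integral>\<^sup>+x\<in>F. u x \<partial>lam) = (\<integral>\<^sup>+x. (\<Sum>i\<in>I. c i * indicator (G i \<inter> F) x) \<partial>lam)"
    using u by (intro nn_integral_cong)
      (auto simp: step_def sum_distrib_right mult.assoc indicator_inter_arith)
  also have "\<dots> = (\<Sum>i\<in>I. \<integral>\<^sup>+x. c i * indicator (G i \<inter> F) x \<partial>lam)"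
    using G F by (intro nn_integral_sum borel_measurable_times_ennreal borel_measurable_const
      borel_measurable_indicator) auto
  also have "\<dots> = (\<Sum>i\<in>I. c i * emeasure lam (G i \<inter> F))"
    using G F by (intro sum.cong nn_integral_cmult_indicator) auto
  finally show ?thesis .
qed

text \<open>Strictness puts \<open>{h \<ge> c}\<close> inside \<open>{u > c}\<close> for positive
  \<open>c\<close>, so that level sets of \<open>h\<close> can be compared with distribution
  functions, which use strict inequalities. Finite support keeps all level pieces of finite
  measure.\<close>

definition strictly_below :: "(real \<Rightarrow> ennreal) \<Rightarrow> (real \<Rightarrow> ennreal) \<Rightarrow> bool" where
  "strictly_below h u \<longleftrightarrow> simple_function lam h \<and> (\<forall>x. h x < \<infinity>)
     \<and> emeasure lam {x \<in> space lam. h x \<noteq> 0} < \<infinity> \<and> (\<forall>x\<in>space lam. h x \<noteq> 0 \<longrightarrow> h x < u x)"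

lemma strictly_below_Mpos: "strictly_below h u \<Longrightarrow> h \<in> Mpos"
  unfolding strictly_below_def Mpos_def by (auto intro: borel_measurable_simple_function)

text \<open>The usual increasing simple approximations are multiplied by factors below 1 to become
  strict and cut off to bounded intervals to have finite support.\<close>

lemma strictly_below_approx:
  assumes "u \<in> Mpos"
  obtains h where "\<And>k. strictly_below (h k) u" "\<And>x. incseq (\<lambda>k::nat. h k x)"
    "\<And>x. 0 \<le> x \<Longrightarrow> (\<lambda>k. h k x) \<longlonglongrightarrow> u x"
proof -
  obtain f where f: "\<And>i. simple_function lam (f i)" "incseq f" "\<And>i x. f i x < top" "\<And>x. (SUP i. f i x) = u x"
    using borel_measurable_implies_simple_function_sequence'[OF assms[unfolded Mpos_def]] by blast
  \<comment> \<open>The shift by 2 keeps \<open>r k\<close> strictly between 0 and 1 from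
    \<open>k = 0\<close> on.\<close>
  define r where "r k = 1 - 1 / real (k + 2)" for k :: nat
  have r: "0 < r k" "r k < 1" for k by (auto simp: r_def field_simps)
  define h where "h k x = ennreal (r k) * f k x * indicator {0..real k} x" for k x
  have inc: "incseq (\<lambda>k. f k x)" for x using f(2) by (auto simp: incseq_def le_fun_def)
  have lim: "(\<lambda>k. f k x) \<longlonglongrightarrow> u x" for x using LIMSEQ_SUP[OF inc[of x]] f(4) by simp
  show thesis
  proof (rule that[of h])
    fix k
    have le: "f k x \<le> u x" for x using f(4)[of x] by (metis SUP_upper UNIV_I)
    show "strictly_below (h k) u"
      unfolding strictly_below_def
    proof (intro conjI allI ballI impI)
      show "simple_function lam (h k)"
        unfolding h_def[abs_def] using f(1)[of k] by (intro simple_function_mult) auto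
      show "h k x < \<infinity>" for x
        using f(3)[of k x] by (auto simp: h_def indicator_def ennreal_mult_less_top)
      have "emeasure lam {x \<in> space lam. h k x \<noteq> 0} \<le> emeasure lam {0..real k}"
        by (intro emeasure_mono) (auto simp: h_def indicator_def)
      also have "\<dots> < \<infinity>" by (simp add: emeasure_lam)
      finally show "emeasure lam {x \<in> space lam. h k x \<noteq> 0} < \<infinity>" .
      fix x assume nz: "h k x \<noteq> 0"
      then have "f k x \<noteq> 0" by (auto simp: h_def)
      then obtain a where a: "f k x = ennreal a" "0 < a"
        using f(3)[of k x] by (cases "f k x") (auto simp: less_le)
      have "h k x \<le> ennreal (r k) * f k x" by (auto simp: h_def indicator_def)
      also have "\<dots> < f k x"
        using a r[of k] by (simp add: ennreal_mult[symmetric] ennreal_less_iff)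
      finally show "h k x < u x" using le[of x] by simp
    qed
  next
    fix x
    show "incseq (\<lambda>k. h k x)"
      unfolding h_def using inc[of x]
      by (intro incseq_SucI mult_mono ennreal_leI) (auto simp: r_def incseq_Suc_iff indicator_def frac_le)
    assume "0 \<le> x"
    obtain K where "x \<le> real K" using real_arch_simple by blast
    then have "eventually (\<lambda>k. indicator {0..real k} x = (1::ennreal)) sequentially"
      using \<open>0 \<le> x\<close> by (auto simp: eventually_sequentially indicator_def intro!: exI[of _ K])
    then have i: "(\<lambda>k. indicator {0..real k} x :: ennreal) \<longlonglongrightarrow> 1" by (rule tendsto_eventually)
    have "(\<lambda>k. r k) \<longlonglongrightarrow> 1 - 0"
      unfolding r_def using LIMSEQ_ignore_initial_segment[OF lim_1_over_n[where 'a=real], of 2]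
      by (intro tendsto_diff tendsto_const) simp
    then have "(\<lambda>k. ennreal (r k)) \<longlonglongrightarrow> 1" using tendsto_ennrealI by fastforce
    \<comment> \<open>Both extra factors tend to 1, so no product of 0 and \<infinity> arises even
      where \<open>u\<close> is infinite.\<close>
    from tendsto_mult_ennreal[OF tendsto_mult_ennreal[OF this lim[of x]] i]
    show "(\<lambda>k. h k x) \<longlonglongrightarrow> u x" by (auto simp: h_def)
  qed
qed

text \<open>Each level set of \<open>h\<close> is cut along the \<open>E n\<close>, the pieces are
  moved by \<open>transfer_sets\<close>, and \<open>F n\<close> collects those that came from
  \<open>E n\<close>. Pieces keep their values and measures, hence the distribution function and all
  the integrals are kept.\<close>

lemma transfer_simple:
  fixes m :: nat
  assumes h: "strictly_below h u" and u: "u \<in> Mpos" and v: "v \<in> Mpos"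
    and distr: "\<And>s. distr u s \<le> distr v s"
    and E: "\<And>n. n < m \<Longrightarrow> E n \<in> sets lam" and disj: "disjoint_family_on E {..<m}"
    and supp: "{x \<in> space lam. h x \<noteq> 0} \<subseteq> (\<Union>n<m. E n)"
  obtains h' F where "h' \<in> Mpos" "\<And>x. h' x \<le> v x" "\<And>s. distr h' s = distr h s"
    "\<And>x. h' x \<noteq> 0 \<Longrightarrow> x \<in> (\<Union>n<m. F n)"
    "\<And>n. n < m \<Longrightarrow> F n \<in> sets lam" "disjoint_family_on F {..<m}"
    "\<And>n. n < m \<Longrightarrow> emeasure lam (F n) \<le> emeasure lam (E n)"
    "\<And>n. n < m \<Longrightarrow> (\<integral>\<^sup>+x\<in>F n. h' x \<partial>lam) = (\<integral>\<^sup>+x\<in>E n. h x \<partial>lam)"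
proof -
  define V where "V = h ` space lam - {0}"
  \<comment> \<open>A pair \<open>(c, n)\<close> labels the part of the level set of
    \<open>c\<close> that lies in \<open>E n\<close>.\<close>
  define I where "I = V \<times> {..<m}"
  define H where "H = (\<lambda>(c, n). {x \<in> space lam. h x = c} \<inter> E n)"
  have "finite (h ` space lam)"
    using h by (intro simple_functionD) (simp add: strictly_below_def)
  then have "finite V" unfolding V_def by blast
  then have fin: "finite V" "finite I" unfolding I_def by blast+
  have lev: "{x \<in> space lam. h x = c} \<in> sets lam" for c
    using simple_functionD(2)[of lam h "{c}"] h
    by (auto simp: strictly_below_def vimage_def Int_def conj_commute)
  have Hs: "H i \<in> sets lam" if "i \<in> I" for i
    using that lev E by (auto simp: H_def I_def)
  have Hdisj: "disjoint_family_on H I"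
    using disj by (fastforce simp: H_def I_def disjoint_family_on_def)
  have hm: "h \<in> Mpos" by (rule strictly_below_Mpos[OF h])
  have nzs: "{x \<in> space lam. h x \<noteq> 0} \<in> sets lam"
    using hm unfolding Mpos_def by measurable
  have h_step: "h x = step I fst H x" if "x \<in> space lam" for x
  proof (cases "h x = 0")
    case True
    then have "x \<notin> (\<Union>i\<in>I. H i)" by (auto simp: H_def I_def V_def)
    then show ?thesis using True by (simp add: step_eq_0)
  next
    case False
    then have "x \<in> {x \<in> space lam. h x \<noteq> 0}" using that by simp
    then obtain n where "n < m" "x \<in> E n" using supp by blast
    then have "(h x, n) \<in> I" "x \<in> H (h x, n)" using False that by (auto simp: I_def V_def H_def)
    from step_eq[OF fin(2) Hdisj this] show ?thesis by simp
  qed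
  have "\<exists>G. (\<forall>i\<in>I. G i \<in> sets lam \<and> emeasure lam (G i) = emeasure lam (H i)
              \<and> (\<forall>x\<in>G i. fst i < v x)) \<and> disjoint_family_on G I"
  proof (rule transfer_sets[OF fin(2) v])
    fix i assume i: "i \<in> I"
    show "fst i < \<infinity>" using i h by (auto simp: I_def V_def strictly_below_def)
    have "emeasure lam (H i) \<le> emeasure lam {x \<in> space lam. h x \<noteq> 0}"
      using nzs i by (intro emeasure_mono) (auto simp: H_def I_def V_def)
    also have "\<dots> < \<infinity>" using h by (simp add: strictly_below_def)
    finally show "H i \<in> sets lam \<and> emeasure lam (H i) < \<infinity>" using Hs[OF i] by simp
    \<comment> \<open>Here strictness enters: a piece of level at least \<open>fst i\<close> lies
      where \<open>u\<close> exceeds \<open>fst i\<close>.\<close>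
    have "emeasure lam (\<Union>j\<in>{j \<in> I. fst i \<le> fst j}. H j) \<le> distr u (fst i)"
      unfolding distr_def
    proof (rule emeasure_mono)
      show "(\<Union>j\<in>{j \<in> I. fst i \<le> fst j}. H j) \<subseteq> {x \<in> space lam. fst i < u x}"
      proof safe
        fix x c n assume x: "(c, n) \<in> I" "fst i \<le> fst (c, n)" "x \<in> H (c, n)"
        then have "x \<in> space lam" "h x = c" "c \<noteq> 0" by (auto simp: H_def I_def V_def)
        moreover from this have "c < u x" using h by (auto simp: strictly_below_def)
        ultimately show "x \<in> space lam" "fst i < u x" using x(2) by auto
      qed
    qed (use superlevel_in_sets[OF u] in auto)
    also note distr
    finally show "emeasure lam (\<Union>j\<in>{j \<in> I. fst i \<le> fst j}. H j) \<le> distr v (fst i)" .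
  qed (rule Hdisj)
  then obtain G where G: "\<And>i. i \<in> I \<Longrightarrow> G i \<in> sets lam"
    "\<And>i. i \<in> I \<Longrightarrow> emeasure lam (G i) = emeasure lam (H i)"
    "\<And>i x. i \<in> I \<Longrightarrow> x \<in> G i \<Longrightarrow> fst i < v x" and Gdisj: "disjoint_family_on G I" by blast
  define F where "F n = (\<Union>c\<in>V. G (c, n))" for n
  have Fs: "F n \<in> sets lam" if "n < m" for n
    using that G(1) fin by (auto simp: F_def I_def)
  \<comment> \<open>Pieces labelled \<open>n\<close> lie inside \<open>F n\<close> and the others
    miss it, exactly as for \<open>H\<close> and \<open>E n\<close>; so the two integrals become the
    same sum.\<close>
  have GF: "G i \<inter> F n = (if snd i = n then G i else {})" if "i \<in> I" "n < m" for i n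
  proof (cases "snd i = n")
    case True
    then have "G i \<subseteq> F n" using that(1) by (auto simp: F_def I_def)
    then show ?thesis using True by auto
  next
    case False
    have "G i \<inter> G (c, n) = {}" if "c \<in> V" for c
    proof (rule disjoint_family_onD[OF Gdisj \<open>i \<in> I\<close>])
      show "(c, n) \<in> I" using that \<open>n < m\<close> by (simp add: I_def)
    qed (use False in auto)
    then show ?thesis using False by (auto simp: F_def)
  qed
  have HE: "H i \<inter> E n = (if snd i = n then H i else {})" if "i \<in> I" "n < m" for i n
    using disjoint_family_onD[OF disj, of "snd i" n] that by (auto simp: H_def I_def split: prod.splits)
  show thesis
  proof (rule that[of "step I fst G" F])
    show "step I fst G \<in> Mpos" by (rule step_in_Mpos[OF G(1)])
    show "step I fst G x \<le> v x" for x
    proof (cases "x \<in> (\<Union>i\<in>I. G i)")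
      case True
      then obtain i where i: "i \<in> I" "x \<in> G i" by blast
      then show ?thesis using G(3)[OF i] step_eq[OF fin(2) Gdisj i, of fst] by simp
    qed (simp add: step_eq_0)
    show "distr (step I fst G) s = distr h s" for s
      using distr_step[OF fin(2) Gdisj G(1), of "step I fst G" fst s]
        distr_step[OF fin(2) Hdisj Hs h_step, of s] G(2) by simp
    show "x \<in> (\<Union>n<m. F n)" if "step I fst G x \<noteq> 0" for x
    proof -
      from that have "x \<in> (\<Union>i\<in>I. G i)" using step_eq_0 by blast
      then show ?thesis by (auto simp: I_def F_def)
    qed
    show "disjoint_family_on F {..<m}"
      unfolding disjoint_family_on_def
    proof safe
      fix n n' x assume "n < m" "n' < m" "n \<noteq> n'" "x \<in> F n" "x \<in> F n'"
      then obtain c where "c \<in> V" "x \<in> G (c, n)" by (auto simp: F_def)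
      then show "x \<in> {}" using GF[of "(c, n)" n'] \<open>n < m\<close> \<open>n' < m\<close> \<open>n \<noteq> n'\<close> \<open>x \<in> F n'\<close>
        by (auto simp: I_def)
    qed
    fix n assume n: "n < m"
    show "F n \<in> sets lam" by (rule Fs[OF n])
    have "emeasure lam (F n) = (\<Sum>c\<in>V. emeasure lam (G (c, n)))"
      unfolding F_def using G(1) Gdisj n fin
      by (intro sum_emeasure[symmetric]) (auto simp: I_def disjoint_family_on_def)
    also have "\<dots> = (\<Sum>c\<in>V. emeasure lam (H (c, n)))"
      using G(2) n by (simp add: I_def)
    also have "\<dots> = emeasure lam (\<Union>c\<in>V. H (c, n))"
      using Hs Hdisj n fin by (intro sum_emeasure) (auto simp: I_def disjoint_family_on_def)
    also have "\<dots> \<le> emeasure lam (E n)"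
      using E[OF n] by (intro emeasure_mono) (auto simp: H_def)
    finally show "emeasure lam (F n) \<le> emeasure lam (E n)" .
    have "(\<integral>\<^sup>+x\<in>F n. step I fst G x \<partial>lam) = (\<Sum>i\<in>I. fst i * emeasure lam (G i \<inter> F n))"
      using fin(2) G(1) Fs[OF n] by (rule set_nn_integral_step) auto
    also have "\<dots> = (\<Sum>i\<in>I. fst i * emeasure lam (H i \<inter> E n))"
      using GF HE n G(2) by (intro sum.cong) auto
    also have "\<dots> = (\<integral>\<^sup>+x\<in>E n. h x \<partial>lam)"
      using fin(2) Hs E[OF n] h_step by (rule set_nn_integral_step[symmetric])
    finally show "(\<integral>\<^sup>+x\<in>F n. step I fst G x \<partial>lam) = (\<integral>\<^sup>+x\<in>E n. h x \<partial>lam)" .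
  qed
qed

subsection \<open>Rearrangement-invariant norms are monotone in the distribution function\<close>

lemma (in banach_function_norm) norm_le_of_approx:
  assumes "\<And>n::nat. F n \<in> Mpos" "f \<in> Mpos"
    "AE x in lam. incseq (\<lambda>n. F n x) \<and> (\<lambda>n. F n x) \<longlonglongrightarrow> f x" "\<And>n. N (emb (F n)) \<le> K"
  shows "N (emb f) \<le> K"
proof -
  have "(\<lambda>n. N (emb (F n))) \<longlonglongrightarrow> N (emb f)"
    using P3[OF assms(1-3)] by simp
  then show ?thesis using assms(4) by (intro LIMSEQ_le_const2) auto
qed

context ri_banach_function_norm
begin

lemma norm_cong_distr:
  assumes "u \<in> Mpos" "v \<in> Mpos" "\<And>s. distr u s = distr v s"
  shows "N (emb u) = N (emb v)"
proof (rule rearrangement_invariant)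
  have "rearr (emb u) = rearr (emb v)"
    by (rule rearr_cong_distr) (simp add: emb_def assms)
  then show "\<forall>t\<ge>0. rearr (emb u) t = rearr (emb v) t" by simp
qed (use assms emb_in_Mfun in auto)

text \<open>A simple function strictly below \<open>u\<close> is equimeasurable with one below
  \<open>v\<close>, so its norm is at most that of \<open>v\<close>; increasing limits then reach
  \<open>u\<close>.\<close>

lemma norm_mono_distr:
  assumes u: "u \<in> Mpos" and v: "v \<in> Mpos" and distr: "\<And>s. distr u s \<le> distr v s"
  shows "N (emb u) \<le> N (emb v)"
proof -
  obtain h where h: "\<And>k. strictly_below (h k) u" "\<And>x. incseq (\<lambda>k::nat. h k x)"
    "\<And>x. 0 \<le> x \<Longrightarrow> (\<lambda>k. h k x) \<longlonglongrightarrow> u x"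
    using strictly_below_approx[OF u] by blast
  show ?thesis
  proof (rule norm_le_of_approx[of h])
    fix k
    have hk: "h k \<in> Mpos" by (rule strictly_below_Mpos[OF h(1)])
    have S: "{x \<in> space lam. h k x \<noteq> 0} \<in> sets lam"
      using hk unfolding Mpos_def by measurable
    \<comment> \<open>With the support of \<open>h k\<close> as the only set, the transfer just
      rearranges \<open>h k\<close> below \<open>v\<close>.\<close>
    obtain h' where "h' \<in> Mpos" "\<And>x. h' x \<le> v x" "\<And>s. distr h' s = distr (h k) s"
    proof (rule transfer_simple[OF h(1)[of k] u v distr, where m=1 and E="\<lambda>_. {x \<in> space lam. h k x \<noteq> 0}"])
      show "disjoint_family_on (\<lambda>_. {x \<in> space lam. h k x \<noteq> 0}) {..<1::nat}"
        by (auto simp: disjoint_family_on_def)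
      show "{x \<in> space lam. h k x \<noteq> 0} \<subseteq> (\<Union>n<1::nat. {x \<in> space lam. h k x \<noteq> 0})"
        by (intro subsetI UN_I[of 0]) auto
    qed (rule S | blast)+
    then show "N (emb (h k)) \<le> N (emb v)"
      using norm_cong_distr[of h' "h k"] P2[of h' v] hk v AE_I2[of lam "\<lambda>x. h' x \<le> v x"] by simp
  qed (use h u in \<open>auto intro: strictly_below_Mpos[of _ u] intro!: AE_I2\<close>)
qed

end

subsection \<open>Averages over sets of measure at most one\<close>

lemma nn_integral_tendsto:
  assumes f: "\<And>n::nat. f n \<in> borel_measurable M" and u: "u \<in> borel_measurable M"
    and ae: "AE x in M. incseq (\<lambda>n. f n x) \<and> (\<lambda>n. f n x) \<longlonglongrightarrow> u x"
  shows "incseq (\<lambda>n. \<integral>\<^sup>+x. f n x \<partial>M)" "(\<lambda>n. \<integral>\<^sup>+x. f n x \<partial>M) \<longlonglongrightarrow> (\<integral>\<^sup>+x. u x \<partial>M)"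
proof -
  have inc: "AE x in M. f n x \<le> f (Suc n) x" for n
    using ae by eventually_elim (auto simp: incseq_Suc_iff)
  show *: "incseq (\<lambda>n. \<integral>\<^sup>+x. f n x \<partial>M)"
    using inc by (intro incseq_SucI nn_integral_mono_AE)
  have "(\<integral>\<^sup>+x. u x \<partial>M) = (\<integral>\<^sup>+x. (SUP n. f n x) \<partial>M)"
  proof (intro nn_integral_cong_AE eventually_mono[OF ae])
    fix x assume "incseq (\<lambda>n. f n x) \<and> (\<lambda>n. f n x) \<longlonglongrightarrow> u x"
    then show "u x = (SUP n. f n x)" using LIMSEQ_SUP LIMSEQ_unique by blast
  qed
  also have "\<dots> = (SUP n. \<integral>\<^sup>+x. f n x \<partial>M)"
    using inc f by (rule nn_integral_monotone_convergence_SUP_AE)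
  finally show "(\<lambda>n. \<integral>\<^sup>+x. f n x \<partial>M) \<longlonglongrightarrow> (\<integral>\<^sup>+x. u x \<partial>M)"
    using LIMSEQ_SUP[OF *] by simp
qed

text \<open>The cells start at \<open>1\<close>, so that the mean of \<open>f*\<close> over \<open>(n, n+1]\<close>, placed on \<open>cell n\<close>,
  dominates \<open>f*\<close> there.\<close>

definition cell :: "nat \<Rightarrow> real set" where
  "cell n = {real n + 1 <.. real n + 2}"

text \<open>The coefficients are plain integrals rather than normalised means, so they survive a
  transfer to sets of smaller measure.\<close>

definition avg :: "nat \<Rightarrow> (nat \<Rightarrow> real set) \<Rightarrow> (real \<Rightarrow> ennreal) \<Rightarrow> real \<Rightarrow> ennreal" where
  "avg m E u = step {..<m} (\<lambda>n. \<integral>\<^sup>+y\<in>E n. u y \<partial>lam) cell"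

definition unit_family :: "nat \<Rightarrow> (nat \<Rightarrow> real set) \<Rightarrow> bool" where
  "unit_family m E \<longleftrightarrow> (\<forall>n<m. E n \<in> sets lam \<and> emeasure lam (E n) \<le> 1) \<and> disjoint_family_on E {..<m}"

lemma cell_in_sets [simp]: "cell n \<in> sets lam"
  by (simp add: cell_def)

lemma emeasure_cell [simp]: "emeasure lam (cell n) = 1"
  unfolding cell_def by (subst emeasure_lam) auto

lemma disjoint_cells: "disjoint_family_on cell I"
  unfolding disjoint_family_on_def cell_def
proof (intro ballI impI)
  fix n n' :: nat assume "n \<noteq> n'"
  then have "real n + 1 \<le> real n' \<or> real n' + 1 \<le> real n" by linarith
  then show "{real n + 1 <.. real n + 2} \<inter> {real n' + 1 <.. real n' + 2} = {}" by auto
qed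

lemma avg_in_Mpos [simp]: "avg m E u \<in> Mpos"
  unfolding avg_def by (rule step_in_Mpos) simp

text \<open>Monotone convergence applies to each coefficient. Since \<open>u\<close> enters only
  through integrals, a hypothesis almost everywhere gives convergence at every point.\<close>

lemma avg_tendsto:
  assumes E: "\<And>n. n < m \<Longrightarrow> E n \<in> sets lam" and f: "\<And>k::nat. f k \<in> Mpos" and u: "u \<in> Mpos"
    and ae: "AE x in lam. incseq (\<lambda>k. f k x) \<and> (\<lambda>k. f k x) \<longlonglongrightarrow> u x"
  shows "incseq (\<lambda>k. avg m E (f k) x)" "(\<lambda>k. avg m E (f k) x) \<longlonglongrightarrow> avg m E u x"
proof -
  have *: "incseq (\<lambda>k. \<integral>\<^sup>+x\<in>E n. f k x \<partial>lam)"
    "(\<lambda>k. \<integral>\<^sup>+x\<in>E n. f k x \<partial>lam) \<longlonglongrightarrow> (\<integral>\<^sup>+x\<in>E n. u x \<partial>lam)" if "n < m" for n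
  proof -
    have ae': "AE x in lam. incseq (\<lambda>k. f k x * indicator (E n) x)
        \<and> (\<lambda>k. f k x * indicator (E n) x) \<longlonglongrightarrow> u x * indicator (E n) x"
      using ae by (rule eventually_mono) (auto simp: indicator_def incseq_def)
    have m: "(\<lambda>x. g x * indicator (E n) x) \<in> borel_measurable lam" if "g \<in> Mpos" for g
      using that E[OF \<open>n < m\<close>] unfolding Mpos_def
      by (intro borel_measurable_times_ennreal borel_measurable_indicator)
    show "incseq (\<lambda>k. \<integral>\<^sup>+x\<in>E n. f k x \<partial>lam)"
      "(\<lambda>k. \<integral>\<^sup>+x\<in>E n. f k x \<partial>lam) \<longlonglongrightarrow> (\<integral>\<^sup>+x\<in>E n. u x \<partial>lam)"
      using nn_integral_tendsto[OF m[OF f] m[OF u] ae'] by auto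
  qed
  show "incseq (\<lambda>k. avg m E (f k) x)"
    using * unfolding avg_def step_def incseq_def by (auto intro!: sum_mono mult_right_mono)
  show "(\<lambda>k. avg m E (f k) x) \<longlonglongrightarrow> avg m E u x"
    unfolding avg_def step_def
  proof (rule tendsto_sum)
    fix n assume "n \<in> {..<m}"
    then show "(\<lambda>k. (\<integral>\<^sup>+x\<in>E n. f k x \<partial>lam) * indicator (cell n) x)
        \<longlonglongrightarrow> (\<integral>\<^sup>+x\<in>E n. u x \<partial>lam) * indicator (cell n) x"
      using *(2)[of n] by (cases "x \<in> cell n") auto
  qed
qed

lemma avg_mono_AE:
  assumes "AE x in lam. u x \<le> v x"
  shows "avg m E u x \<le> avg m E v x"
  unfolding avg_def step_def using assms
  by (intro sum_mono mult_right_mono nn_integral_mono_AE) (auto elim!: eventually_mono intro: mult_right_mono)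

lemma sum_set_nn_integral_le:
  assumes "unit_family m E" "u \<in> Mpos"
  shows "(\<Sum>n<m. \<integral>\<^sup>+y\<in>E n. u y \<partial>lam) \<le> (\<integral>\<^sup>+y. u y \<partial>lam)"
proof -
  have disj: "disjoint_family_on E {..<m}" and E: "\<And>n. n < m \<Longrightarrow> E n \<in> sets lam"
    using assms(1) by (auto simp: unit_family_def)
  have "(\<Sum>n<m. \<integral>\<^sup>+y\<in>E n. u y \<partial>lam) = (\<integral>\<^sup>+y. (\<Sum>n<m. u y * indicator (E n) y) \<partial>lam)"
    using assms(2) E unfolding Mpos_def
    by (intro nn_integral_sum[symmetric] borel_measurable_times_ennreal borel_measurable_indicator) auto
  also have "\<dots> \<le> (\<integral>\<^sup>+y. u y \<partial>lam)"
  proof (rule nn_integral_mono)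
    fix y
    \<comment> \<open>By disjointness at most one summand is nonzero at \<open>y\<close>.\<close>
    have "step {..<m} (\<lambda>_. u y) E y \<le> u y"
      using step_eq[OF _ disj, of _ y "\<lambda>_. u y"] step_eq_0[of y E "{..<m}" "\<lambda>_. u y"]
      by (cases "y \<in> (\<Union>n<m. E n)") auto
    then show "(\<Sum>n<m. u y * indicator (E n) y) \<le> u y" by (simp add: step_def)
  qed
  finally show ?thesis .
qed

lemma distr_indicator:
  "E \<in> sets lam \<Longrightarrow> distr (indicator E) s = (if s < 1 then emeasure lam E else 0)"
proof -
  assume "E \<in> sets lam"
  then have "{x \<in> space lam. s < indicator E x} = (if s < 1 then E else {})"
    by (auto simp: indicator_def sets_lam_iff)
  then show ?thesis by (simp add: distr_def)
qed

lemma indicator_in_Mpos [simp]: "E \<in> sets lam \<Longrightarrow> indicator E \<in> Mpos"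
  unfolding Mpos_def by (rule borel_measurable_indicator)

section \<open>Combinatorics of cyclic shifts and multiplicities\<close>

lemma cyclic_sum:
  fixes g :: "nat \<Rightarrow> 'a::comm_monoid_add"
  shows "(\<Sum>l<N. g ((l + s) mod N)) = (\<Sum>l<N. g l)"
proof (cases N)
  case (Suc M)
  show ?thesis
  proof (induction s)
    case (Suc s)
    let ?g = "\<lambda>l. g ((l + s) mod N)"
    \<comment> \<open>One further shift makes the first summand the last, since the indices 0 and
      \<open>N\<close> agree modulo \<open>N\<close>.\<close>
    have "(\<Sum>l<N. g ((l + Suc s) mod N)) = (\<Sum>l<M. ?g (Suc l)) + ?g N"
      by (simp add: \<open>N = Suc M\<close>)
    also have "?g N = ?g 0" by simp
    also have "(\<Sum>l<M. ?g (Suc l)) + ?g 0 = (\<Sum>l<N. ?g l)"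
      unfolding \<open>N = Suc M\<close> sum.lessThan_Suc_shift by (simp add: add.commute)
    finally show ?case using Suc by simp
  qed simp
qed simp

text \<open>\<open>w\<close> lists each \<open>c\<close> with multiplicity \<open>k c\<close>,
  padded with zeros to length \<open>N\<close>. Sums of functions \<phi> vanishing at 0 do not see
  the padding and cover both uses: counting the entries above a level and adding up all
  entries.\<close>

lemma list_with_multiplicities:
  fixes k :: "ennreal \<Rightarrow> nat"
  assumes "finite V" "(\<Sum>c\<in>V. k c) \<le> N"
  obtains w :: "nat \<Rightarrow> ennreal" where
    "\<And>\<phi>::ennreal \<Rightarrow> ennreal. \<phi> 0 = 0 \<Longrightarrow> (\<Sum>l<N. \<phi> (w l)) = (\<Sum>c\<in>V. of_nat (k c) * \<phi> c)"
proof -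
  have "\<exists>xs. length xs = (\<Sum>c\<in>V. k c) \<and>
      (\<forall>\<phi>::ennreal \<Rightarrow> ennreal. sum_list (map \<phi> xs) = (\<Sum>c\<in>V. of_nat (k c) * \<phi> c))"
    using assms(1)
  proof induction
    case (insert c V)
    then obtain xs where xs: "length xs = (\<Sum>c\<in>V. k c)"
      "\<And>\<phi>::ennreal \<Rightarrow> ennreal. sum_list (map \<phi> xs) = (\<Sum>c\<in>V. of_nat (k c) * \<phi> c)" by blast
    show ?case
      using insert(1,2) xs by (intro exI[of _ "replicate (k c) c @ xs"]) (simp add: sum_list_replicate)
  qed simp
  then obtain xs where xs: "length xs = (\<Sum>c\<in>V. k c)"
      "\<And>\<phi>::ennreal \<Rightarrow> ennreal. sum_list (map \<phi> xs) = (\<Sum>c\<in>V. of_nat (k c) * \<phi> c)" by blast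
  show ?thesis
  proof (rule that[of "\<lambda>l. if l < length xs then xs ! l else 0"])
    fix \<phi> :: "ennreal \<Rightarrow> ennreal" assume "\<phi> 0 = 0"
    then have "(\<Sum>l<N. \<phi> (if l < length xs then xs ! l else 0)) = (\<Sum>l<length xs. \<phi> (xs ! l))"
      using xs(1) assms(2) by (intro sum.mono_neutral_cong_right) auto
    also have "\<dots> = sum_list (map \<phi> xs)"
      by (simp add: sum_list_sum_nth atLeast0LessThan)
    finally show "(\<Sum>l<N. \<phi> (if l < length xs then xs ! l else 0)) = (\<Sum>c\<in>V. of_nat (k c) * \<phi> c)"
      using xs(2) by simp
  qed
qed

lemma simple_function_eq_step:
  assumes h: "simple_function lam h" and x: "x \<in> space lam"
  shows "h x = step (h ` space lam - {0}) (\<lambda>c. c) (\<lambda>c. {x \<in> space lam. h x = c}) x"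
proof (cases "h x = 0")
  case True
  then show ?thesis by (subst step_eq_0) auto
next
  case False
  then show ?thesis
    using simple_functionD(1)[OF h] x
    by (subst step_eq[of _ _ "h x"]) (auto simp: disjoint_family_on_def)
qed

section \<open>Boundedness of averaging\<close>

context ri_banach_function_norm
begin

lemma norm_sum_le:
  assumes "finite I" "\<And>i. i \<in> I \<Longrightarrow> f i \<in> Mpos"
  shows "N (emb (\<lambda>x. \<Sum>i\<in>I. f i x)) \<le> (\<Sum>i\<in>I. N (emb (f i)))"
  using assms
proof (induction I)
  case empty
  have "N (emb (\<lambda>x. 0)) = 0" by (subst P1_zero) (auto simp: Mpos_def)
  then show ?case by simp
next
  case (insert i I)
  have "(\<lambda>x. \<Sum>i\<in>I. f i x) \<in> Mpos"
    using insert.prems unfolding Mpos_def by (intro borel_measurable_sum) auto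
  then have "N (emb (\<lambda>x. f i x + (\<Sum>i\<in>I. f i x))) \<le> N (emb (f i)) + N (emb (\<lambda>x. \<Sum>i\<in>I. f i x))"
    using insert.prems by (intro P1_triangle) auto
  also have "\<dots> \<le> N (emb (f i)) + (\<Sum>i\<in>I. N (emb (f i)))"
    using insert by (intro add_left_mono) auto
  finally show ?case using insert by simp
qed

text \<open>The fundamental function of \<open>N\<close> at 1: by rearrangement invariance every
  cell has this norm.\<close>

definition cell_norm :: ennreal where "cell_norm = N (emb (indicator (cell 0)))"

lemma norm_cell: "N (emb (indicator (cell n))) = cell_norm"
  unfolding cell_norm_def by (rule norm_cong_distr) (auto simp: distr_indicator)

lemma cell_norm_finite: "cell_norm < \<infinity>"
  unfolding cell_norm_def by (rule P4) auto

lemma cell_norm_nonzero: "cell_norm \<noteq> 0"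
proof
  assume "cell_norm = 0"
  then have "AE x in lam. indicator (cell 0) x = (0::ennreal)"
    unfolding cell_norm_def by (subst (asm) P1_zero) auto
  then have "AE x in lam. x \<notin> cell 0" by (auto elim!: eventually_mono simp: indicator_def split: if_splits)
  then have "emeasure lam (cell 0) = 0" by (subst AE_iff_measurable[symmetric, where P="\<lambda>x. x \<notin> cell 0"]) (auto simp: cell_def)
  then show False by simp
qed

text \<open>The triangle inequality over the cells gives \<open>cell_norm\<close> times the sum of
  the coefficients, and disjointness of the \<open>E n\<close> bounds that sum by the total
  integral.\<close>

lemma norm_avg_le_integral:
  assumes E: "unit_family m E" and u: "u \<in> Mpos"
  shows "N (emb (avg m E u)) \<le> cell_norm * (\<integral>\<^sup>+y. u y \<partial>lam)"
\<comment> \<open>Homogeneity is available for real scalars only, so infinite integrals are treated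
  apart; there the bound is infinite because \<open>cell_norm\<close> is nonzero.\<close>
proof (cases "(\<integral>\<^sup>+y. u y \<partial>lam) = \<infinity>")
  case True
  then show ?thesis using cell_norm_nonzero by (simp add: ennreal_mult_top)
next
  case False
  let ?b = "\<lambda>n. \<integral>\<^sup>+y\<in>E n. u y \<partial>lam"
  have fin: "?b n < \<infinity>" if "n < m" for n
  proof -
    have "?b n \<le> (\<integral>\<^sup>+y. u y \<partial>lam)" by (intro nn_integral_mono) (auto simp: indicator_def)
    also have "\<dots> < \<infinity>" using False by (simp add: less_top[symmetric])
    finally show ?thesis .
  qed
  have m: "(\<lambda>x. ?b n * indicator (cell n) x) \<in> Mpos" for n
    unfolding Mpos_def by (intro borel_measurable_times_ennreal borel_measurable_indicator) auto
  have "N (emb (avg m E u)) \<le> (\<Sum>n<m. N (emb (\<lambda>x. ?b n * indicator (cell n) x)))"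
    unfolding avg_def step_def using m by (intro norm_sum_le) auto
  also have "\<dots> = (\<Sum>n<m. ?b n * cell_norm)"
  proof (rule sum.cong)
    fix n assume "n \<in> {..<m}"
    then obtain b where "?b n = ennreal b" "0 \<le> b" using fin[of n] by (cases "?b n") auto
    then show "N (emb (\<lambda>x. ?b n * indicator (cell n) x)) = ?b n * cell_norm"
      using P1_homogeneous[of "indicator (cell n)" b] norm_cell by simp
  qed simp
  also have "\<dots> = cell_norm * (\<Sum>n<m. ?b n)" by (simp add: sum_distrib_left mult.commute)
  also have "\<dots> \<le> cell_norm * (\<integral>\<^sup>+y. u y \<partial>lam)"
    by (intro mult_left_mono sum_set_nn_integral_le[OF E u]) simp
  finally show ?thesis .
qed

text \<open>Cut each cell into \<open>R\<close> equal pieces and spread over them a list in which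
  the value \<open>c\<close> of \<open>h\<close> occurs about \<open>R * \<mu> c n\<close> times.
  Every cyclic shift \<open>v s\<close> has norm at most that of \<open>h\<close>, while the mean of
  all shifts is constant on each cell and at least half of the average.\<close>

lemma norm_avg_simple_le:
  assumes E: "unit_family m E" and h: "strictly_below h u"
  shows "N (emb (avg m E h)) \<le> 2 * N (emb h)"
proof -
  have hsf: "simple_function lam h" and hfin: "\<And>x. h x < \<infinity>"
    and supp: "emeasure lam {x \<in> space lam. h x \<noteq> 0} < \<infinity>"
    using h by (auto simp: strictly_below_def)
  have hm: "h \<in> Mpos" by (rule strictly_below_Mpos[OF h])
  have disj: "disjoint_family_on E {..<m}" and Es: "\<And>n. n < m \<Longrightarrow> E n \<in> sets lam"
    and E1: "\<And>n. n < m \<Longrightarrow> emeasure lam (E n) \<le> 1"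
    using E by (auto simp: unit_family_def)
  define V where "V = h ` space lam - {0}"
  define S where "S c = {x \<in> space lam. h x = c}" for c
  define \<mu> where "\<mu> c n = measure lam (S c \<inter> E n)" for c n
  have finV: "finite V" unfolding V_def using simple_functionD(1)[OF hsf] by (rule finite_Diff)
  have Ss: "S c \<in> sets lam" for c
    using simple_functionD(2)[OF hsf, of "{c}"] by (auto simp: S_def vimage_def Int_def conj_commute)
  have Sdisj: "disjoint_family_on S V" by (auto simp: disjoint_family_on_def S_def)
  have mu: "emeasure lam (S c \<inter> E n) = ennreal (\<mu> c n)" if "n < m" for c n
  proof -
    have "emeasure lam (S c \<inter> E n) \<le> emeasure lam (E n)" using Es[OF that] by (intro emeasure_mono) auto
    also note E1[OF that]
    finally show ?thesis unfolding \<mu>_def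
      by (intro emeasure_eq_ennreal_measure) (auto simp: top_unique)
  qed
  have mu_sum: "(\<Sum>c\<in>V. \<mu> c n) \<le> 1" if "n < m" for n
  proof -
    have "ennreal (\<Sum>c\<in>V. \<mu> c n) = (\<Sum>c\<in>V. emeasure lam (S c \<inter> E n))"
      using that by (simp add: mu sum_ennreal \<mu>_def)
    also have "\<dots> = emeasure lam (\<Union>c\<in>V. S c \<inter> E n)"
      using finV Ss Es[OF that] Sdisj by (intro sum_emeasure) (auto simp: disjoint_family_on_def)
    also have "\<dots> \<le> emeasure lam (E n)" using Es[OF that] by (intro emeasure_mono) auto
    also note E1[OF that]
    finally show ?thesis by simp
  qed
  \<comment> \<open>All positive \<open>\<mu> c n\<close> are at least \<open>1 / R\<close>, so rounding \<open>R * \<mu> c n\<close> down loses at most a factor two.\<close>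
  define R :: nat where "R = Suc (nat \<lceil>\<Sum>c\<in>V. \<Sum>n<m. 1 / \<mu> c n\<rceil>)"
  have R: "1 / \<mu> c n \<le> real R" if "c \<in> V" "n < m" for c n
  proof -
    have "1 / \<mu> c n \<le> (\<Sum>n<m. 1 / \<mu> c n)"
      using that by (intro member_le_sum) (auto simp: \<mu>_def)
    also have "\<dots> \<le> (\<Sum>c\<in>V. \<Sum>n<m. 1 / \<mu> c n)"
      using that finV by (intro member_le_sum[of c V "\<lambda>c. \<Sum>n<m. 1 / \<mu> c n"]) (auto intro!: sum_nonneg simp: \<mu>_def)
    also have "\<dots> \<le> real R" unfolding R_def by linarith
    finally show ?thesis .
  qed
  have R0: "0 < R" by (simp add: R_def)
  define k where "k n c = nat \<lfloor>real R * \<mu> c n\<rfloor>" for n c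
  have k_le: "real (k n c) \<le> real R * \<mu> c n" for n c
    by (simp add: k_def \<mu>_def)
  have k_ge: "real R * \<mu> c n \<le> 2 * real (k n c)" if "c \<in> V" "n < m" for n c
  \<comment> \<open>For positive \<open>\<mu> c n\<close> the product with \<open>R\<close> is at
    least 1, and a real number at least 1 is at most twice its floor.\<close>
  proof (cases "\<mu> c n = 0")
    case False
    then have "0 < \<mu> c n" by (simp add: \<mu>_def zero_less_measure_iff)
    then have "1 \<le> real R * \<mu> c n" using R[OF that] by (simp add: field_simps)
    then have "1 \<le> \<lfloor>real R * \<mu> c n\<rfloor>" by simp
    moreover from this have "real (k n c) = of_int \<lfloor>real R * \<mu> c n\<rfloor>" by (simp add: k_def)
    ultimately show ?thesis using floor_correct[of "real R * \<mu> c n"] by linarith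
  qed simp
  have "\<forall>n\<in>{..<m}. \<exists>w::nat \<Rightarrow> ennreal. \<forall>\<phi>::ennreal \<Rightarrow> ennreal. \<phi> 0 = 0 \<longrightarrow>
      (\<Sum>l<R. \<phi> (w l)) = (\<Sum>c\<in>V. of_nat (k n c) * \<phi> c)"
  proof
    fix n assume "n \<in> {..<m}"
    then have that: "n < m" by simp
    \<comment> \<open>The multiplicities fit into a list of length \<open>R\<close> because the
      masses inside \<open>E n\<close> add up to at most 1.\<close>
    have "real (\<Sum>c\<in>V. k n c) \<le> (\<Sum>c\<in>V. real R * \<mu> c n)"
      using k_le by (simp add: sum_mono)
    also have "\<dots> \<le> real R * 1"
      unfolding sum_distrib_left[symmetric] using mu_sum[OF that] by (intro mult_left_mono) auto
    finally have "(\<Sum>c\<in>V. k n c) \<le> R" by (simp del: of_nat_sum)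
    from list_with_multiplicities[OF finV this]
    show "\<exists>w::nat \<Rightarrow> ennreal. \<forall>\<phi>::ennreal \<Rightarrow> ennreal. \<phi> 0 = 0 \<longrightarrow>
      (\<Sum>l<R. \<phi> (w l)) = (\<Sum>c\<in>V. of_nat (k n c) * \<phi> c)" by blast
  qed
  from bchoice[OF this] obtain w :: "nat \<Rightarrow> nat \<Rightarrow> ennreal" where w: "\<And>n \<phi>::ennreal \<Rightarrow> ennreal. n < m \<Longrightarrow> \<phi> 0 = 0 \<Longrightarrow>
      (\<Sum>l<R. \<phi> (w n l)) = (\<Sum>c\<in>V. of_nat (k n c) * \<phi> c)" by auto
  \<comment> \<open>\<open>J (n, l)\<close> is the \<open>l\<close>-th of \<open>R\<close> equal
    half-open pieces of \<open>cell n\<close>.\<close>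
  define J :: "nat \<times> nat \<Rightarrow> real set" where
    "J = (\<lambda>(n, l). {real n + 1 + real l / real R <.. real n + 1 + (real l + 1) / real R})"
  define I where "I = {..<m} \<times> {..<R}"
  have finI: "finite I" by (simp add: I_def)
  have Js: "J i \<in> sets lam" for i by (cases i) (auto simp: J_def)
  have Jm: "emeasure lam (J i) = ennreal (1 / real R)" for i
  proof (cases i)
    case (Pair n l)
    let ?a = "real n + 1 + real l / real R" and ?b = "real n + 1 + (real l + 1) / real R"
    have ab: "?b = ?a + 1 / real R" by (simp add: add_divide_distrib)
    have "0 \<le> ?a" by simp
    then have "{?a<..?b} \<subseteq> {0..}"
      by (meson atLeast_iff greaterThanAtMost_iff less_imp_le order_trans subsetI)
    then have "J i \<subseteq> {0..}" by (simp add: J_def Pair)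
    then have "emeasure lam (J i) = emeasure lborel {?a<..?b}"
      by (simp add: emeasure_lam J_def Pair)
    also have "\<dots> = ennreal (?b - ?a)" unfolding ab by (rule emeasure_lborel_Ioc) simp
    finally show ?thesis unfolding ab by simp
  qed
  \<comment> \<open>Scaling by \<open>R\<close> turns membership into an equation for a ceiling,
    where \<open>R * n + l\<close> numbers the pieces consecutively; division by \<open>R\<close>
    then recovers the labels.\<close>
  have J_iff: "x \<in> J (n, l) \<longleftrightarrow> \<lceil>real R * (x - 1)\<rceil> = int (R * n + l) + 1" for x n l
  proof -
    have "x \<in> J (n, l) \<longleftrightarrow> real l / real R < x - 1 - real n \<and> x - 1 - real n \<le> (real l + 1) / real R"
      by (auto simp: J_def)
    also have "\<dots> \<longleftrightarrow> real l < (x - 1 - real n) * real R \<and> (x - 1 - real n) * real R \<le> real l + 1"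
      using R0 by (simp only: pos_divide_less_eq pos_le_divide_eq of_nat_0_less_iff)
    also have "\<dots> \<longleftrightarrow> \<lceil>real R * (x - 1)\<rceil> = int (R * n + l) + 1"
      unfolding ceiling_eq_iff by (simp add: algebra_simps)
    finally show ?thesis .
  qed
  have Jdisj: "disjoint_family_on J I"
    unfolding disjoint_family_on_def
  proof (intro ballI impI equals0I)
    fix i i' x assume i: "i \<in> I" "i' \<in> I" "i \<noteq> i'" "x \<in> J i \<inter> J i'"
    obtain n l n' l' where p: "i = (n, l)" "i' = (n', l')" by (metis surj_pair)
    have *: "(n, l) \<in> I" "(n', l') \<in> I" "x \<in> J (n, l)" "x \<in> J (n', l')" using i p by auto
    then have "int (R * n + l) + 1 = int (R * n' + l') + 1" unfolding J_iff by simp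
    then have "R * n + l = R * n' + l'" by (simp only: add_right_cancel of_nat_eq_iff)
    moreover have "l < R" "l' < R" using * by (simp_all add: I_def)
    ultimately have "R * n + l = R * n' + l'" "l < R" "l' < R" by simp_all
    then have "(R * n + l) div R = (R * n' + l') div R" "(R * n + l) mod R = (R * n' + l') mod R" by simp_all
    with \<open>l < R\<close> \<open>l' < R\<close> have "n = n'" "l = l'" by simp_all
    with i p show False by simp
  qed
  \<comment> \<open>In every cell the list \<open>w n\<close> is placed on the pieces after a cyclic
    shift by \<open>s\<close>.\<close>
  define v where "v s = step I (\<lambda>(n, l). w n ((l + s) mod R)) J" for s
  have vm: "v s \<in> Mpos" for s unfolding v_def by (rule step_in_Mpos[OF Js])
  have v_norm: "N (emb (v s)) \<le> N (emb h)" for s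
  proof (rule norm_mono_distr[OF vm hm])
    fix t :: ennreal
    \<comment> \<open>A piece with entry \<open>c\<close> contributes its length to the distribution
      function when \<open>c\<close> exceeds \<open>t\<close>; the entry 0 never does, as
      \<open>w\<close> requires.\<close>
    let ?\<phi> = "\<lambda>c. if t < c then ennreal (1 / real R) else 0"
    have "distr (v s) t = (\<Sum>i\<in>{i\<in>I. t < (\<lambda>(n, l). w n ((l + s) mod R)) i}. emeasure lam (J i))"
      using finI Jdisj Js by (rule distr_step) (simp add: v_def)
    also have "\<dots> = (\<Sum>i\<in>I. if t < (\<lambda>(n, l). w n ((l + s) mod R)) i then ennreal (1 / real R) else 0)"
      unfolding Jm by (rule sum.inter_filter[OF finI])
    also have "\<dots> = (\<Sum>n<m. \<Sum>l<R. ?\<phi> (w n ((l + s) mod R)))"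
      unfolding I_def by (simp add: sum.cartesian_product case_prod_unfold)
    also have "\<dots> = (\<Sum>n<m. \<Sum>l<R. ?\<phi> (w n l))"
      using cyclic_sum[where g="\<lambda>l. ?\<phi> (w n l)" and N=R and s=s for n] by simp
    also have "\<dots> = (\<Sum>n<m. \<Sum>c\<in>V. of_nat (k n c) * ?\<phi> c)"
      using w[of _ ?\<phi>] by (intro sum.cong) auto
    \<comment> \<open>This is where rounding down is needed: \<open>c\<close> occupies length
      \<open>k n c / R\<close> in \<open>cell n\<close>, which is at most
      \<open>\<mu> c n\<close>.\<close>
    also have "\<dots> \<le> (\<Sum>n<m. emeasure lam ({x \<in> space lam. t < h x} \<inter> E n))"
    proof (rule sum_mono)
      fix n assume "n \<in> {..<m}"
      then have n: "n < m" by simp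
      have "(\<Sum>c\<in>V. of_nat (k n c) * ?\<phi> c) \<le> (\<Sum>c\<in>V. if t < c then emeasure lam (S c \<inter> E n) else 0)"
      proof (intro sum_mono)
        fix c
        have "of_nat (k n c) * ennreal (1 / real R) = ennreal (real (k n c) / real R)"
          by (simp add: ennreal_of_nat_eq_real_of_nat ennreal_mult[symmetric])
        also have "\<dots> \<le> ennreal (\<mu> c n)"
          using k_le[of n c] R0 by (intro ennreal_leI) (simp add: field_simps)
        finally show "of_nat (k n c) * ?\<phi> c \<le> (if t < c then emeasure lam (S c \<inter> E n) else 0)"
          using mu[OF n] by simp
      qed
      also have "\<dots> = (\<Sum>c\<in>{c\<in>V. t < c}. emeasure lam (S c \<inter> E n))"
        by (rule sum.inter_filter[OF finV, symmetric])
      also have "\<dots> = emeasure lam (\<Union>c\<in>{c\<in>V. t < c}. S c \<inter> E n)"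
        using finV Ss Es[OF n] Sdisj by (intro sum_emeasure) (auto simp: disjoint_family_on_def)
      also have "\<dots> \<le> emeasure lam ({x \<in> space lam. t < h x} \<inter> E n)"
        using superlevel_in_sets[OF hm, of t] Es[OF n] by (intro emeasure_mono sets.Int) (auto simp: S_def)
      finally show "(\<Sum>c\<in>V. of_nat (k n c) * ?\<phi> c) \<le> emeasure lam ({x \<in> space lam. t < h x} \<inter> E n)" .
    qed
    also have "\<dots> = emeasure lam (\<Union>n<m. {x \<in> space lam. t < h x} \<inter> E n)"
      using superlevel_in_sets[OF hm, of t] Es disj
      by (intro sum_emeasure) (auto simp: disjoint_family_on_def)
    also have "\<dots> \<le> distr h t"
      unfolding distr_def using superlevel_in_sets[OF hm, of t] by (intro emeasure_mono) auto
    finally show "distr (v s) t \<le> distr h t" .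
  qed
  let ?a = "ennreal (2 / real R)"
  have pt: "avg m E h x \<le> ?a * (\<Sum>s<R. v s x)" for x
  proof (cases "x \<in> (\<Union>n<m. cell n)")
    case False
    then show ?thesis unfolding avg_def by (subst step_eq_0) auto
  next
    case True
    then obtain n where n: "n < m" "x \<in> cell n" by blast
    \<comment> \<open>The position, within \<open>cell n\<close>, of the piece that contains
      \<open>x\<close>.\<close>
    define l where "l = nat (\<lceil>real R * (x - 1)\<rceil> - int (R * n) - 1)"
    have "real R * real n < real R * (x - 1)" "real R * (x - 1) \<le> real R * (real n + 1)"
      using n(2) R0 by (auto simp: cell_def)
    then have "of_int (int (R * n)) < real R * (x - 1)" "real R * (x - 1) \<le> of_int (int (R * n) + int R)"
      by (simp_all add: algebra_simps)
    then have "int (R * n) < \<lceil>real R * (x - 1)\<rceil>" "\<lceil>real R * (x - 1)\<rceil> \<le> int (R * n) + int R"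
      unfolding less_ceiling_iff ceiling_le_iff by blast+
    then have l: "l < R" "x \<in> J (n, l)" unfolding J_iff by (auto simp: l_def)
    have "v s x = w n ((l + s) mod R)" for s
      using step_eq[OF finI Jdisj, of "(n, l)" x] n l by (simp add: v_def I_def)
    \<comment> \<open>As \<open>s\<close> runs through all shifts, a fixed piece receives each list
      entry once, so the sum is the same on all pieces of the cell.\<close>
    then have "(\<Sum>s<R. v s x) = (\<Sum>s<R. w n ((s + l) mod R))" by (simp add: add.commute)
    also have "\<dots> = (\<Sum>c\<in>V. of_nat (k n c) * c)"
      using w[OF n(1), of "\<lambda>c. c"] by (simp add: cyclic_sum)
    finally have vsum: "(\<Sum>s<R. v s x) = (\<Sum>c\<in>V. of_nat (k n c) * c)" .
    have "avg m E h x = (\<integral>\<^sup>+y\<in>E n. h y \<partial>lam)"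
      unfolding avg_def using n by (subst step_eq[of _ _ n]) (auto simp: disjoint_cells)
    also have "\<dots> = (\<Sum>c\<in>V. c * emeasure lam (S c \<inter> E n))"
      using finV Ss Es[OF n(1)] simple_function_eq_step[OF hsf, folded S_def V_def]
      by (rule set_nn_integral_step)
    \<comment> \<open>The factor 2 in \<open>?a\<close> pays for the rounding of the
      multiplicities.\<close>
    also have "\<dots> \<le> (\<Sum>c\<in>V. c * (?a * of_nat (k n c)))"
    proof (intro sum_mono mult_left_mono)
      fix c assume "c \<in> V"
      have "emeasure lam (S c \<inter> E n) \<le> ennreal (2 / real R * real (k n c))"
        unfolding mu[OF n(1)] using k_ge[OF \<open>c \<in> V\<close> n(1)] R0 by (intro ennreal_leI) (simp add: field_simps)
      then show "emeasure lam (S c \<inter> E n) \<le> ?a * of_nat (k n c)"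
        by (simp add: ennreal_of_nat_eq_real_of_nat ennreal_mult[symmetric])
    qed simp
    also have "\<dots> = ?a * (\<Sum>s<R. v s x)"
      unfolding vsum by (simp add: sum_distrib_left mult_ac)
    finally show ?thesis .
  qed
  have sm: "(\<lambda>x. \<Sum>s<R. v s x) \<in> Mpos"
    using vm unfolding Mpos_def by (intro borel_measurable_sum) auto
  have "N (emb (avg m E h)) \<le> N (emb (\<lambda>x. ?a * (\<Sum>s<R. v s x)))"
    using pt sm avg_in_Mpos by (intro P2 AE_I2) (auto simp: Mpos_def)
  also have "\<dots> = ?a * N (emb (\<lambda>x. \<Sum>s<R. v s x))"
    using sm by (rule P1_homogeneous) simp
  also have "\<dots> \<le> ?a * (\<Sum>s<R. N (emb (v s)))"
    using vm by (intro mult_left_mono norm_sum_le) auto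
  also have "\<dots> \<le> ?a * (\<Sum>s<R. N (emb h))"
    by (intro mult_left_mono sum_mono v_norm) simp
  also have "\<dots> = 2 * N (emb h)"
    using R0 by (simp add: mult.assoc[symmetric] ennreal_of_nat_eq_real_of_nat ennreal_mult[symmetric])
  finally show ?thesis .
qed

text \<open>The averages of simple functions increasing to \<open>u\<close> increase to the average
  of \<open>u\<close> at every point, so the bound for simple functions passes to the limit.\<close>

lemma norm_avg_le:
  assumes E: "unit_family m E" and u: "u \<in> Mpos"
  shows "N (emb (avg m E u)) \<le> 2 * N (emb u)"
proof -
  obtain h where h: "\<And>k. strictly_below (h k) u" "\<And>x. incseq (\<lambda>k::nat. h k x)"
    "\<And>x. 0 \<le> x \<Longrightarrow> (\<lambda>k. h k x) \<longlonglongrightarrow> u x"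
    using strictly_below_approx[OF u] by blast
  have hm: "h k \<in> Mpos" for k by (rule strictly_below_Mpos[OF h(1)])
  have ae: "AE x in lam. incseq (\<lambda>k. h k x) \<and> (\<lambda>k. h k x) \<longlonglongrightarrow> u x"
    using h(2,3) by (intro AE_I2) auto
  have Es: "\<And>n. n < m \<Longrightarrow> E n \<in> sets lam" using E by (simp add: unit_family_def)
  show ?thesis
  proof (rule norm_le_of_approx[of "\<lambda>k. avg m E (h k)"])
    fix k
    have "h k x \<le> u x" if "0 \<le> x" for x
      using h(2)[of x] h(3)[OF that] by (rule incseq_le)
    then have "N (emb (h k)) \<le> N (emb u)" using hm u by (intro P2 AE_I2) auto
    then show "N (emb (avg m E (h k))) \<le> 2 * N (emb u)"
      using norm_avg_simple_le[OF E h(1)[of k]] by (meson mult_left_mono order_trans zero_le)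
  qed (use avg_tendsto[OF Es hm u ae] in \<open>auto intro!: AE_I2\<close>)
qed

end

subsection \<open>The local and the global part of the norm\<close>

definition loc_norm :: "((real \<Rightarrow> ecomplex) \<Rightarrow> ennreal) \<Rightarrow> (real \<Rightarrow> ennreal) \<Rightarrow> ennreal" where
  "loc_norm A u = (SUP E\<in>{E \<in> sets lam. emeasure lam E \<le> 1}. A (emb (\<lambda>x. u x * indicator E x)))"

definition glob_norm :: "((real \<Rightarrow> ecomplex) \<Rightarrow> ennreal) \<Rightarrow> (real \<Rightarrow> ennreal) \<Rightarrow> ennreal" where
  "glob_norm B u = (SUP (m, E)\<in>{(m, E). unit_family m E}. B (emb (avg m E u)))"

lemma loc_norm_upper:
  "E \<in> sets lam \<Longrightarrow> emeasure lam E \<le> 1 \<Longrightarrow> A (emb (\<lambda>x. u x * indicator E x)) \<le> loc_norm A u"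
  unfolding loc_norm_def by (rule SUP_upper) simp

lemma glob_norm_upper: "unit_family m E \<Longrightarrow> B (emb (avg m E u)) \<le> glob_norm B u"
  unfolding glob_norm_def using SUP_upper[of "(m, E)" _ "\<lambda>(m, E). B (emb (avg m E u))"] by auto

lemma loc_norm_least:
  "(\<And>E. E \<in> sets lam \<Longrightarrow> emeasure lam E \<le> 1 \<Longrightarrow> A (emb (\<lambda>x. u x * indicator E x)) \<le> K) \<Longrightarrow> loc_norm A u \<le> K"
  unfolding loc_norm_def by (rule SUP_least) simp

lemma glob_norm_least:
  "(\<And>m E. unit_family m E \<Longrightarrow> B (emb (avg m E u)) \<le> K) \<Longrightarrow> glob_norm B u \<le> K"
  unfolding glob_norm_def by (rule SUP_least) auto

lemma times_indicator_in_Mpos [simp]: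
  "u \<in> Mpos \<Longrightarrow> E \<in> sets lam \<Longrightarrow> (\<lambda>x. u x * indicator E x) \<in> Mpos"
  unfolding Mpos_def by (intro borel_measurable_times_ennreal borel_measurable_indicator)

lemma times_indicator_le: "(c::ennreal) * indicator E x \<le> c"
  by (simp add: indicator_def)

lemma add_in_Mpos [simp]: "u \<in> Mpos \<Longrightarrow> v \<in> Mpos \<Longrightarrow> (\<lambda>x. u x + v x) \<in> Mpos"
  unfolding Mpos_def by (rule borel_measurable_add)

lemma distr_mono:
  assumes "v \<in> Mpos" "\<And>x. 0 \<le> x \<Longrightarrow> u x \<le> v x"
  shows "distr u s \<le> distr v s"
  unfolding distr_def using assms superlevel_in_sets[OF assms(1), of s]
  by (intro emeasure_mono) (auto intro: less_le_trans)

lemma avg_add: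
  assumes E: "unit_family m E" and u: "u \<in> Mpos" and v: "v \<in> Mpos"
  shows "avg m E (\<lambda>x. u x + v x) = (\<lambda>x. avg m E u x + avg m E v x)"
proof -
  have "(\<integral>\<^sup>+x\<in>E n. (u x + v x) \<partial>lam) = (\<integral>\<^sup>+x\<in>E n. u x \<partial>lam) + (\<integral>\<^sup>+x\<in>E n. v x \<partial>lam)" if "n < m" for n
  proof -
    have "E n \<in> sets lam" using E that by (simp add: unit_family_def)
    then show ?thesis
      using times_indicator_in_Mpos[OF u] times_indicator_in_Mpos[OF v]
      unfolding Mpos_def by (simp add: distrib_right nn_integral_add)
  qed
  then show ?thesis
    by (intro ext) (simp add: avg_def step_def distrib_right sum.distrib)
qed

lemma avg_scale:
  assumes E: "unit_family m E" and u: "u \<in> Mpos"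
  shows "avg m E (\<lambda>x. a * u x) = (\<lambda>x. a * avg m E u x)"
proof -
  have "(\<integral>\<^sup>+x\<in>E n. (a * u x) \<partial>lam) = a * (\<integral>\<^sup>+x\<in>E n. u x \<partial>lam)" if "n < m" for n
  proof -
    have "E n \<in> sets lam" using E that by (simp add: unit_family_def)
    then show ?thesis
      using times_indicator_in_Mpos[OF u] unfolding Mpos_def by (simp add: mult.assoc nn_integral_cmult)
  qed
  then show ?thesis
    unfolding avg_def step_def sum_distrib_left mult.assoc[symmetric]
    by (intro ext sum.cong arg_cong2[where f="(*)"]) auto
qed

section \<open>Dependence on the distribution function alone\<close>

context ri_banach_function_norm
begin

text \<open>A simple function below \<open>u\<close> on \<open>E\<close> is moved below
  \<open>v\<close> onto a set of measure at most that of \<open>E\<close>, which is admissible in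
  the supremum for \<open>v\<close>.\<close>

lemma loc_norm_mono_distr:
  assumes u: "u \<in> Mpos" and v: "v \<in> Mpos" and distr: "\<And>s. distr u s \<le> distr v s"
  shows "loc_norm N u \<le> loc_norm N v"
proof (rule loc_norm_least)
  fix E assume E: "E \<in> sets lam" "emeasure lam E \<le> 1"
  define u' where "u' x = u x * indicator E x" for x
  have u': "u' \<in> Mpos" unfolding u'_def using u E by simp
  have distr': "distr u' s \<le> distr v s" for s
    using distr_mono[OF u, of u' s] distr[of s] by (simp add: u'_def times_indicator_le)
  obtain h where h: "\<And>k. strictly_below (h k) u'" "\<And>x. incseq (\<lambda>k::nat. h k x)"
    "\<And>x. 0 \<le> x \<Longrightarrow> (\<lambda>k. h k x) \<longlonglongrightarrow> u' x"
    using strictly_below_approx[OF u'] by blast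
  have "N (emb u') \<le> loc_norm N v"
  proof (rule norm_le_of_approx[of h])
    fix k
    have hk: "h k \<in> Mpos" by (rule strictly_below_Mpos[OF h(1)])
    obtain h' F where h': "h' \<in> Mpos" "\<And>x. h' x \<le> v x" "\<And>s. distr h' s = distr (h k) s"
      "\<And>x. h' x \<noteq> 0 \<Longrightarrow> x \<in> (\<Union>n<1::nat. F n)" "F 0 \<in> sets lam" "emeasure lam (F 0) \<le> emeasure lam E"
    proof (rule transfer_simple[OF h(1)[of k] u' v distr', where m=1 and E="\<lambda>_. E"])
      show "disjoint_family_on (\<lambda>_. E) {..<1::nat}" by (auto simp: disjoint_family_on_def)
      show "{x \<in> space lam. h k x \<noteq> 0} \<subseteq> (\<Union>n<1::nat. E)"
      proof
        fix x assume x: "x \<in> {x \<in> space lam. h k x \<noteq> 0}"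
        then have "h k x < u' x" using h(1)[of k] by (auto simp: strictly_below_def)
        then have "u' x \<noteq> 0" by auto
        then have "x \<in> E" unfolding u'_def by (metis indicator_simps(2) mult_zero_right)
        then show "x \<in> (\<Union>n<1::nat. E)" by blast
      qed
      show "E \<in> sets lam" by (rule E)
    qed blast
    have "N (emb (h k)) = N (emb h')" using h' hk by (intro norm_cong_distr) auto
    also have "\<dots> \<le> N (emb (\<lambda>x. v x * indicator (F 0) x))"
    proof (intro P2 AE_I2)
      fix x
      show "h' x \<le> v x * indicator (F 0) x"
        using h'(2,4)[of x] by (cases "h' x = 0") auto
    qed (use h' v in auto)
    also have "\<dots> \<le> loc_norm N v"
      using h'(5,6) E by (intro loc_norm_upper) auto
    finally show "N (emb (h k)) \<le> loc_norm N v" .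
  qed (use h u' in \<open>auto intro: strictly_below_Mpos[of _ u'] intro!: AE_I2\<close>)
  then show "N (emb (\<lambda>x. u x * indicator E x)) \<le> loc_norm N v"
    by (simp add: u'_def[abs_def])
qed

text \<open>The transfer turns \<open>E\<close> into another unit family \<open>F\<close> and keeps
  the integral over each member, so the averages of the simple functions over \<open>E\<close> and
  over \<open>F\<close> coincide as functions.\<close>

lemma glob_norm_mono_distr:
  assumes u: "u \<in> Mpos" and v: "v \<in> Mpos" and distr: "\<And>s. distr u s \<le> distr v s"
  shows "glob_norm N u \<le> glob_norm N v"
proof (rule glob_norm_least)
  fix m E assume E: "unit_family m E"
  have Es: "\<And>n. n < m \<Longrightarrow> E n \<in> sets lam" and disj: "disjoint_family_on E {..<m}"
    using E by (auto simp: unit_family_def)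
  \<comment> \<open>Cutting \<open>u\<close> off outside the family leaves its averages unchanged
    and supplies the support condition of the transfer.\<close>
  define u' where "u' x = u x * indicator (\<Union>n<m. E n) x" for x
  have u': "u' \<in> Mpos" unfolding u'_def using u Es by (intro times_indicator_in_Mpos) auto
  have distr': "distr u' s \<le> distr v s" for s
    using distr_mono[OF u, of u' s] distr[of s] by (simp add: u'_def times_indicator_le)
  have avg': "avg m E u = avg m E u'"
    unfolding avg_def step_def
  proof (intro ext sum.cong)
    fix x n assume "n \<in> {..<m}"
    then have "(\<integral>\<^sup>+y\<in>E n. u y \<partial>lam) = (\<integral>\<^sup>+y\<in>E n. u' y \<partial>lam)"
      by (intro nn_integral_cong) (auto simp: u'_def indicator_def)
    then show "(\<integral>\<^sup>+y\<in>E n. u y \<partial>lam) * indicator (cell n) x = (\<integral>\<^sup>+y\<in>E n. u' y \<partial>lam) * indicator (cell n) x"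
      by simp
  qed simp
  obtain h where h: "\<And>k. strictly_below (h k) u'" "\<And>x. incseq (\<lambda>k::nat. h k x)"
    "\<And>x. 0 \<le> x \<Longrightarrow> (\<lambda>k. h k x) \<longlonglongrightarrow> u' x"
    using strictly_below_approx[OF u'] by blast
  have hm: "h k \<in> Mpos" for k by (rule strictly_below_Mpos[OF h(1)])
  have ae: "AE x in lam. incseq (\<lambda>k. h k x) \<and> (\<lambda>k. h k x) \<longlonglongrightarrow> u' x"
    using h(2,3) by (intro AE_I2) auto
  have "N (emb (avg m E u')) \<le> glob_norm N v"
  proof (rule norm_le_of_approx[of "\<lambda>k. avg m E (h k)"])
    fix k
    obtain h' F where h': "h' \<in> Mpos" "\<And>x. h' x \<le> v x"
      "\<And>n. n < m \<Longrightarrow> F n \<in> sets lam" "disjoint_family_on F {..<m}"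
      "\<And>n. n < m \<Longrightarrow> emeasure lam (F n) \<le> emeasure lam (E n)"
      "\<And>n. n < m \<Longrightarrow> (\<integral>\<^sup>+x\<in>F n. h' x \<partial>lam) = (\<integral>\<^sup>+x\<in>E n. h k x \<partial>lam)"
    proof (rule transfer_simple[OF h(1)[of k] u' v distr' Es disj])
      show "{x \<in> space lam. h k x \<noteq> 0} \<subseteq> (\<Union>n<m. E n)"
      proof
        fix x assume x: "x \<in> {x \<in> space lam. h k x \<noteq> 0}"
        then have "h k x < u' x" using h(1)[of k] by (auto simp: strictly_below_def)
        then have "u' x \<noteq> 0" by auto
        then show "x \<in> (\<Union>n<m. E n)" unfolding u'_def by (metis indicator_simps(2) mult_zero_right)
      qed
    qed blast+
    have F: "unit_family m F"
      unfolding unit_family_def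
    proof (intro conjI allI impI)
      fix n assume n: "n < m"
      show "emeasure lam (F n) \<le> 1"
        using h'(5)[OF n] E n by (auto simp: unit_family_def intro: order_trans)
    qed (use h' in auto)
    have "avg m E (h k) = avg m F h'"
      unfolding avg_def step_def using h'(6) by (intro ext sum.cong) auto
    then have "N (emb (avg m E (h k))) \<le> N (emb (avg m F v))"
      using h'(2) by (auto intro!: P2 AE_I2 avg_mono_AE)
    also have "\<dots> \<le> glob_norm N v" by (rule glob_norm_upper[OF F])
    finally show "N (emb (avg m E (h k))) \<le> glob_norm N v" .
  qed (use avg_tendsto[OF Es hm u' ae] in \<open>auto intro!: AE_I2\<close>)
  then show "N (emb (avg m E u)) \<le> glob_norm N v" unfolding avg' .
qed

section \<open>Norm axioms for the two parts\<close>

lemma loc_norm_scale: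
  assumes "u \<in> Mpos" "0 \<le> a"
  shows "loc_norm N (\<lambda>x. ennreal a * u x) = ennreal a * loc_norm N u"
  unfolding loc_norm_def SUP_mult_left_ennreal
proof (rule SUP_cong)
  fix E assume "E \<in> {E \<in> sets lam. emeasure lam E \<le> 1}"
  then show "N (emb (\<lambda>x. ennreal a * u x * indicator E x)) = ennreal a * N (emb (\<lambda>x. u x * indicator E x))"
    using P1_homogeneous[of "\<lambda>x. u x * indicator E x" a] assms by (simp add: mult.assoc)
qed simp

lemma glob_norm_scale:
  assumes "u \<in> Mpos" "0 \<le> a"
  shows "glob_norm N (\<lambda>x. ennreal a * u x) = ennreal a * glob_norm N u"
  unfolding glob_norm_def SUP_mult_left_ennreal
proof (rule SUP_cong)
  fix p :: "nat \<times> (nat \<Rightarrow> real set)" assume "p \<in> {(m, E). unit_family m E}"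
  then show "(case p of (m, E) \<Rightarrow> N (emb (avg m E (\<lambda>x. ennreal a * u x))))
      = ennreal a * (case p of (m, E) \<Rightarrow> N (emb (avg m E u)))"
    using assms by (cases p) (simp add: avg_scale P1_homogeneous)
qed simp

lemma loc_norm_triangle:
  assumes "u \<in> Mpos" "v \<in> Mpos"
  shows "loc_norm N (\<lambda>x. u x + v x) \<le> loc_norm N u + loc_norm N v"
proof (rule loc_norm_least)
  fix E assume E: "E \<in> sets lam" "emeasure lam E \<le> 1"
  have "N (emb (\<lambda>x. (u x + v x) * indicator E x))
      \<le> N (emb (\<lambda>x. u x * indicator E x)) + N (emb (\<lambda>x. v x * indicator E x))"
    unfolding distrib_right using assms E by (intro P1_triangle) auto
  also have "\<dots> \<le> loc_norm N u + loc_norm N v"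
    using E by (intro add_mono loc_norm_upper)
  finally show "N (emb (\<lambda>x. (u x + v x) * indicator E x)) \<le> loc_norm N u + loc_norm N v" .
qed

lemma glob_norm_triangle:
  assumes "u \<in> Mpos" "v \<in> Mpos"
  shows "glob_norm N (\<lambda>x. u x + v x) \<le> glob_norm N u + glob_norm N v"
proof (rule glob_norm_least)
  fix m E assume E: "unit_family m E"
  have "N (emb (avg m E (\<lambda>x. u x + v x))) \<le> N (emb (avg m E u)) + N (emb (avg m E v))"
    unfolding avg_add[OF E assms] by (intro P1_triangle) auto
  also have "\<dots> \<le> glob_norm N u + glob_norm N v"
    using E by (intro add_mono glob_norm_upper)
  finally show "N (emb (avg m E (\<lambda>x. u x + v x))) \<le> glob_norm N u + glob_norm N v" .
qed

text \<open>Lower semicontinuity passes to suprema: for fixed \<open>E\<close> the Fatou property of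
  \<open>N\<close> applies to the restrictions of the \<open>F n\<close>, each bounded by its local
  norm.\<close>

lemma loc_norm_fatou:
  assumes F: "\<And>n::nat. F n \<in> Mpos" and f: "f \<in> Mpos"
    and ae: "AE x in lam. incseq (\<lambda>n. F n x) \<and> (\<lambda>n. F n x) \<longlonglongrightarrow> f x"
  shows "loc_norm N f \<le> (SUP n. loc_norm N (F n))"
proof (rule loc_norm_least)
  fix E assume E: "E \<in> sets lam" "emeasure lam E \<le> 1"
  show "N (emb (\<lambda>x. f x * indicator E x)) \<le> (SUP n. loc_norm N (F n))"
  proof (rule norm_le_of_approx)
    show "AE x in lam. incseq (\<lambda>n. F n x * indicator E x)
        \<and> (\<lambda>n. F n x * indicator E x) \<longlonglongrightarrow> f x * indicator E x"
      using ae by (rule eventually_mono) (auto simp: indicator_def incseq_def)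
    show "N (emb (\<lambda>x. F n x * indicator E x)) \<le> (SUP n. loc_norm N (F n))" for n
      using loc_norm_upper[OF E] by (rule SUP_upper2[OF UNIV_I])
  qed (use F f E in auto)
qed

lemma glob_norm_fatou:
  assumes F: "\<And>n::nat. F n \<in> Mpos" and f: "f \<in> Mpos"
    and ae: "AE x in lam. incseq (\<lambda>n. F n x) \<and> (\<lambda>n. F n x) \<longlonglongrightarrow> f x"
  shows "glob_norm N f \<le> (SUP n. glob_norm N (F n))"
proof (rule glob_norm_least)
  fix m E assume E: "unit_family m E"
  then have Es: "\<And>n. n < m \<Longrightarrow> E n \<in> sets lam" by (auto simp: unit_family_def)
  show "N (emb (avg m E f)) \<le> (SUP n. glob_norm N (F n))"
  proof (rule norm_le_of_approx[of "\<lambda>n. avg m E (F n)"])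
    show "N (emb (avg m E (F n))) \<le> (SUP n. glob_norm N (F n))" for n
      using glob_norm_upper[OF E] by (rule SUP_upper2[OF UNIV_I])
  qed (use avg_tendsto[OF Es F f ae] in \<open>auto intro!: AE_I2\<close>)
qed

lemma loc_norm_le: "u \<in> Mpos \<Longrightarrow> loc_norm N u \<le> N (emb u)"
  by (rule loc_norm_least) (auto intro!: P2 AE_I2 times_indicator_le)

text \<open>Countably many unit intervals cover the half-line, and each of them is admissible in the
  supremum.\<close>

lemma AE_zero_if_loc_norm_zero:
  assumes u: "u \<in> Mpos" and 0: "loc_norm N u = 0"
  shows "AE x in lam. u x = 0"
proof -
  have "AE x in lam. u x * indicator {real n..real n + 1} x = 0" for n
  proof -
    have "N (emb (\<lambda>x. u x * indicator {real n..real n + 1} x)) \<le> loc_norm N u"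
      by (rule loc_norm_upper) (auto simp: emeasure_lam subset_iff)
    then show ?thesis using 0 u by (subst P1_zero[symmetric]) auto
  qed
  then have "AE x in lam. \<forall>n. u x * indicator {real n..real n + 1} x = 0"
    by (subst AE_all_countable) blast
  then show ?thesis
  proof (rule AE_mp, intro AE_I2 impI)
    fix x assume "x \<in> space lam" and *: "\<forall>n. u x * indicator {real n..real n + 1} x = 0"
    then have "x \<in> {real (nat \<lfloor>x\<rfloor>)..real (nat \<lfloor>x\<rfloor>) + 1}"
      using floor_correct[of x] by auto
    then show "u x = 0" using *[rule_format, of "nat \<lfloor>x\<rfloor>"] by simp
  qed
qed

text \<open>\<open>E\<close> is split into finitely many sets of measure at most 1. On each of them
  \<open>P5\<close> is applied to the restriction of \<open>u\<close>, whose norm is dominated by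
  the local norm; the constants add up.\<close>

lemma set_nn_integral_le_loc_norm:
  assumes "E \<in> sets lam" "emeasure lam E \<le> of_nat M"
  shows "\<exists>C<\<infinity>. \<forall>u\<in>Mpos. (\<integral>\<^sup>+x\<in>E. u x \<partial>lam) \<le> C * loc_norm N u"
  using assms
proof (induction M arbitrary: E)
  case 0
  then have "E \<in> null_sets lam" by auto
  then have "(\<integral>\<^sup>+x\<in>E. u x \<partial>lam) = 0" for u
    by (rule nn_integral_null_set)
  then show ?case by (intro exI[of _ 0]) simp
next
  case (Suc M)
  have base: "\<exists>C<\<infinity>. \<forall>u\<in>Mpos. (\<integral>\<^sup>+x\<in>G. u x \<partial>lam) \<le> C * loc_norm N u"
    if G: "G \<in> sets lam" "emeasure lam G \<le> 1" for G
  proof -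
    have "emeasure lam G < \<infinity>" using G(2) by (rule le_less_trans) simp
    then obtain C where C: "C < \<infinity>" "\<And>f. f \<in> Mpos \<Longrightarrow> (\<integral>\<^sup>+x\<in>G. f x \<partial>lam) \<le> C * N (emb f)"
      using P5[OF G(1)] by blast
    have "(\<integral>\<^sup>+x\<in>G. u x \<partial>lam) \<le> C * loc_norm N u" if u: "u \<in> Mpos" for u
    proof -
      have "(\<integral>\<^sup>+x\<in>G. u x \<partial>lam) = (\<integral>\<^sup>+x\<in>G. (u x * indicator G x) \<partial>lam)"
        by (intro nn_integral_cong) (simp add: indicator_def)
      also have "\<dots> \<le> C * N (emb (\<lambda>x. u x * indicator G x))"
        using u G by (intro C(2)) auto
      also have "\<dots> \<le> C * loc_norm N u"
        using G by (intro mult_left_mono loc_norm_upper) auto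
      finally show ?thesis .
    qed
    with C(1) show ?thesis by blast
  qed
  show ?case
  proof (cases "emeasure lam E \<le> 1")
    case True
    then show ?thesis using base Suc.prems by blast
  next
    case False
    then have "1 \<le> emeasure lam E" by simp
    \<comment> \<open>Removing measure exactly 1 lowers the bound for the remainder to
      \<open>of_nat M\<close>.\<close>
    then obtain G where G: "G \<in> sets lam" "G \<subseteq> E" "emeasure lam G = 1"
      by (rule subset_of_emeasure[OF Suc.prems(1)]) simp
    have EG: "E - G \<in> sets lam" using G Suc.prems by auto
    have "emeasure lam G + emeasure lam (E - G) = emeasure lam E"
      using G EG by (subst plus_emeasure) (auto simp: Un_absorb1)
    then have "1 + emeasure lam (E - G) \<le> 1 + of_nat M"
      using G(3) Suc.prems(2) by simp
    then have "emeasure lam (E - G) \<le> of_nat M" by (simp add: ennreal_add_left_cancel_le)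
    then obtain C1 where C1: "C1 < \<infinity>" "\<And>u. u \<in> Mpos \<Longrightarrow> (\<integral>\<^sup>+x\<in>E - G. u x \<partial>lam) \<le> C1 * loc_norm N u"
      using Suc.IH[OF EG] by blast
    obtain C2 where C2: "C2 < \<infinity>" "\<And>u. u \<in> Mpos \<Longrightarrow> (\<integral>\<^sup>+x\<in>G. u x \<partial>lam) \<le> C2 * loc_norm N u"
      using base[of G] G by auto
    have "(\<integral>\<^sup>+x\<in>E. u x \<partial>lam) \<le> (C1 + C2) * loc_norm N u" if u: "u \<in> Mpos" for u
    proof -
      have "(\<integral>\<^sup>+x\<in>E. u x \<partial>lam) = (\<integral>\<^sup>+x. (u x * indicator (E - G) x + u x * indicator G x) \<partial>lam)"
        using G(2) by (intro nn_integral_cong) (auto simp: indicator_def)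
      also have "\<dots> = (\<integral>\<^sup>+x\<in>E - G. u x \<partial>lam) + (\<integral>\<^sup>+x\<in>G. u x \<partial>lam)"
        using times_indicator_in_Mpos[OF u] EG G(1) unfolding Mpos_def by (intro nn_integral_add) auto
      also have "\<dots> \<le> (C1 + C2) * loc_norm N u"
        unfolding distrib_right using u by (intro add_mono C1(2) C2(2))
      finally show ?thesis .
    qed
    moreover have "C1 + C2 < \<infinity>" using C1(1) C2(1) by simp
    ultimately show ?thesis by blast
  qed
qed

section \<open>Comparison with the rearrangement\<close>

lemma glob_norm_le_integral: "u \<in> Mpos \<Longrightarrow> glob_norm N u \<le> cell_norm * (\<integral>\<^sup>+y. u y \<partial>lam)"
  by (intro glob_norm_least norm_avg_le_integral)

lemma glob_norm_le: "u \<in> Mpos \<Longrightarrow> glob_norm N u \<le> 2 * N (emb u)"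
  by (intro glob_norm_least norm_avg_le)

text \<open>The interval \<open>{0..1}\<close> is admissible in the supremum for
  \<open>rearr f\<close>. Conversely, a non-increasing function has its largest restriction, in the
  sense of distribution functions, on \<open>{0..1}\<close> among all sets of measure at most
  1.\<close>

lemma loc_norm_eq_rearr:
  assumes f: "f \<in> Mfun"
  shows "loc_norm N (\<lambda>x. emod (f x)) = N (emb (\<lambda>t. rearr f t * indicator {0..1} t))"
proof (rule antisym)
  have r: "rearr f \<in> Mpos" by (rule rearr_in_Mpos[OF f])
  have u: "(\<lambda>x. emod (f x)) \<in> Mpos" by (rule emod_in_Mpos[OF f])
  have "N (emb (\<lambda>t. rearr f t * indicator {0..1} t)) \<le> loc_norm N (rearr f)"
    by (rule loc_norm_upper) (auto simp: emeasure_lam)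
  also have "\<dots> \<le> loc_norm N (\<lambda>x. emod (f x))"
    using r u by (rule loc_norm_mono_distr) (simp add: distr_rearr[OF f])
  finally show "N (emb (\<lambda>t. rearr f t * indicator {0..1} t)) \<le> loc_norm N (\<lambda>x. emod (f x))" .
  have "loc_norm N (\<lambda>x. emod (f x)) \<le> loc_norm N (rearr f)"
    using u r by (rule loc_norm_mono_distr) (simp add: distr_rearr[OF f])
  also have "\<dots> \<le> N (emb (\<lambda>t. rearr f t * indicator {0..1} t))"
  proof (rule loc_norm_least, rule norm_mono_distr)
    fix E s assume E: "E \<in> sets lam" "emeasure lam E \<le> 1"
    let ?r = "\<lambda>t. rearr f t * indicator {0..1} t"
    show "distr (\<lambda>x. rearr f x * indicator E x) s \<le> distr ?r s"
    \<comment> \<open>Either the superlevel set contains \<open>{0..1}\<close>, and then measure 1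
      is enough to dominate \<open>E\<close>, or it lies within \<open>{0..1}\<close>, and the
      restriction on the right loses nothing.\<close>
    proof (cases "\<exists>t>1. s < rearr f t")
      case True
      then have gt: "s < rearr f x" if "x \<le> 1" for x
        using rearr_antimono[of x _ f] that by (meson less_le_trans less_imp_le order_trans)
      have "distr (\<lambda>x. rearr f x * indicator E x) s \<le> emeasure lam E"
        unfolding distr_def using E by (intro emeasure_mono) (auto simp: indicator_def split: if_splits)
      also have "\<dots> \<le> emeasure lam {0..1}" using E by (simp add: emeasure_lam)
      also have "\<dots> \<le> distr ?r s"
        unfolding distr_def using gt r by (intro emeasure_mono superlevel_in_sets times_indicator_in_Mpos) auto
      finally show ?thesis .
    next
      case False
      show ?thesis
        unfolding distr_def using False r
        by (intro emeasure_mono superlevel_in_sets times_indicator_in_Mpos)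
          (auto simp: indicator_def not_less split: if_splits intro: le_less_trans)
    qed
  qed (use r in auto)
  finally show "loc_norm N (\<lambda>x. emod (f x)) \<le> N (emb (\<lambda>t. rearr f t * indicator {0..1} t))" .
qed

text \<open>By monotonicity, \<open>rearr f\<close> on \<open>cell n\<close> is at most its mean
  over the unit interval to the left, so averages over consecutive unit intervals dominate the tail,
  first up to \<open>m + 1\<close> and then in the limit.\<close>

lemma norm_rearr_tail_le:
  assumes f: "f \<in> Mfun"
  shows "N (emb (\<lambda>t. rearr f t * indicator {1<..} t)) \<le> glob_norm N (\<lambda>x. emod (f x))"
proof -
  have r: "rearr f \<in> Mpos" by (rule rearr_in_Mpos[OF f])
  have "N (emb (\<lambda>t. rearr f t * indicator {1<..} t)) \<le> glob_norm N (rearr f)"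
  proof (rule norm_le_of_approx)
    fix m :: nat
    let ?E = "\<lambda>n. {real n<..real n + 1}"
    have disj: "disjoint_family_on ?E {..<m}"
      unfolding disjoint_family_on_def
    proof (intro ballI impI)
      fix n n' :: nat assume "n \<noteq> n'"
      then have "real n + 1 \<le> real n' \<or> real n' + 1 \<le> real n" by linarith
      then show "{real n<..real n + 1} \<inter> {real n'<..real n' + 1} = {}" by auto
    qed
    have E: "unit_family m ?E"
      using disj by (auto simp: unit_family_def emeasure_lam subset_iff)
    have "N (emb (\<lambda>t. rearr f t * indicator {1<..real m + 1} t)) \<le> N (emb (avg m ?E (rearr f)))"
    proof (intro P2 AE_I2)
      fix t :: real
      show "rearr f t * indicator {1<..real m + 1} t \<le> avg m ?E (rearr f) t"
      proof (cases "t \<in> {1<..real m + 1}")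
        case True
        \<comment> \<open>\<open>cell n\<close> consists of the points with ceiling
          \<open>n + 2\<close>.\<close>
        define n where "n = nat (\<lceil>t\<rceil> - 2)"
        have "2 \<le> \<lceil>t\<rceil>" "\<lceil>t\<rceil> \<le> int m + 1" using True by (auto simp: le_ceiling_iff ceiling_le_iff)
        then have n: "n < m" "real n = of_int \<lceil>t\<rceil> - 2" unfolding n_def by linarith+
        then have t: "t \<in> cell n" using ceiling_correct[of t] by (auto simp: cell_def)
        have "rearr f t = (\<integral>\<^sup>+x\<in>?E n. rearr f t \<partial>lam)"
          by (simp add: nn_integral_cmult_indicator emeasure_lam subset_iff)
        also have "\<dots> \<le> (\<integral>\<^sup>+x\<in>?E n. rearr f x \<partial>lam)"
          using t by (intro nn_integral_mono) (auto simp: indicator_def cell_def intro!: rearr_antimono)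
        also have "\<dots> = avg m ?E (rearr f) t"
          unfolding avg_def using n t by (subst step_eq[of _ _ n]) (auto simp: disjoint_cells)
        finally show ?thesis using True by simp
      qed simp
    qed (use r in auto)
    also have "\<dots> \<le> glob_norm N (rearr f)" by (rule glob_norm_upper[OF E])
    finally show "N (emb (\<lambda>t. rearr f t * indicator {1<..real m + 1} t)) \<le> glob_norm N (rearr f)" .
  next
    show "AE t in lam. incseq (\<lambda>m. rearr f t * indicator {1<..real m + 1} t)
        \<and> (\<lambda>m. rearr f t * indicator {1<..real m + 1} t) \<longlonglongrightarrow> rearr f t * indicator {1<..} t"
    proof (intro AE_I2 conjI)
      fix t :: real
      show "incseq (\<lambda>m. rearr f t * indicator {1<..real m + 1} t)"
        by (auto simp: incseq_def indicator_def)
      obtain M where "t \<le> real M" using real_arch_simple by blast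
      then have "eventually (\<lambda>m. rearr f t * indicator {1<..real m + 1} t = rearr f t * indicator {1<..} t) sequentially"
        by (auto simp: eventually_sequentially indicator_def intro!: exI[of _ M])
      then show "(\<lambda>m. rearr f t * indicator {1<..real m + 1} t) \<longlonglongrightarrow> rearr f t * indicator {1<..} t"
        by (rule tendsto_eventually)
    qed
  qed (use r in auto)
  also have "\<dots> \<le> glob_norm N (\<lambda>x. emod (f x))"
    using r emod_in_Mpos[OF f] by (rule glob_norm_mono_distr) (simp add: distr_rearr[OF f])
  finally show ?thesis .
qed

text \<open>Split \<open>rearr f\<close> at 1. The head need not have finite \<open>N\<close>-norm,
  so its averages are estimated by its integral; the tail is handled by the boundedness of
  averaging.\<close>

lemma glob_norm_le_rearr:
  assumes f: "f \<in> Mfun"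
  shows "glob_norm N (\<lambda>x. emod (f x))
    \<le> cell_norm * (\<integral>\<^sup>+t\<in>{0..1}. rearr f t \<partial>lam) + 2 * N (emb (\<lambda>t. rearr f t * indicator {1<..} t))"
proof -
  have r: "rearr f \<in> Mpos" by (rule rearr_in_Mpos[OF f])
  let ?u = "\<lambda>t. rearr f t * indicator {0..1} t" and ?v = "\<lambda>t. rearr f t * indicator {1<..} t"
  have uv: "?u \<in> Mpos" "?v \<in> Mpos" using r by auto
  have "glob_norm N (\<lambda>x. emod (f x)) \<le> glob_norm N (\<lambda>t. ?u t + ?v t)"
  proof (rule glob_norm_mono_distr[OF emod_in_Mpos[OF f] add_in_Mpos[OF uv]])
    fix s
    have "distr (rearr f) s \<le> distr (\<lambda>t. ?u t + ?v t) s"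
      using add_in_Mpos[OF uv] by (rule distr_mono) (auto simp: indicator_def)
    then show "distr (\<lambda>x. emod (f x)) s \<le> distr (\<lambda>t. ?u t + ?v t) s"
      by (simp add: distr_rearr[OF f])
  qed
  also have "\<dots> \<le> glob_norm N ?u + glob_norm N ?v" by (rule glob_norm_triangle[OF uv])
  also have "\<dots> \<le> cell_norm * (\<integral>\<^sup>+t. ?u t \<partial>lam) + 2 * N (emb ?v)"
    using uv by (intro add_mono glob_norm_le_integral glob_norm_le)
  finally show ?thesis .
qed

end

subsection \<open>The equivalent norm\<close>

definition amalgam_norm ::
    "((real \<Rightarrow> ecomplex) \<Rightarrow> ennreal) \<Rightarrow> ((real \<Rightarrow> ecomplex) \<Rightarrow> ennreal) \<Rightarrow> (real \<Rightarrow> ecomplex) \<Rightarrow> ennreal" where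
  "amalgam_norm A B f = loc_norm A (\<lambda>x. emod (f x)) + glob_norm B (\<lambda>x. emod (f x))"

lemma amalgam_norm_emb [simp]: "amalgam_norm A B (emb u) = loc_norm A u + glob_norm B u"
  by (simp add: amalgam_norm_def emb_def)

text \<open>Homogeneity, subadditivity and the Fatou property hold for both parts; invariance under
  rearrangement and under changes on null sets follows from monotonicity in the distribution
  function. Definiteness and \<open>P5\<close> come from the local part.\<close>

lemma ri_amalgam_norm:
  assumes A: "ri_banach_function_norm A" and B: "ri_banach_function_norm B"
  shows "ri_banach_function_norm (amalgam_norm A B)"
proof -
  interpret A: ri_banach_function_norm A by (rule A)
  interpret B: ri_banach_function_norm B by (rule B)
  have mono: "loc_norm A u + glob_norm B u \<le> loc_norm A v + glob_norm B v"
    if "u \<in> Mpos" "v \<in> Mpos" "\<And>s. distr u s \<le> distr v s" for u v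
    using that by (intro add_mono A.loc_norm_mono_distr B.glob_norm_mono_distr)
  have mono_AE: "loc_norm A u + glob_norm B u \<le> loc_norm A v + glob_norm B v"
    if "u \<in> Mpos" "v \<in> Mpos" "AE x in lam. u x \<le> v x" for u v
    using that by (intro mono distr_AE_mono)
  show ?thesis
  proof
    fix f g assume fg: "f \<in> Mfun" "g \<in> Mfun" "AE x in lam. f x = g x"
    have "AE x in lam. emod (f x) \<le> emod (g x)" "AE x in lam. emod (g x) \<le> emod (f x)"
      using fg(3) by (auto elim!: eventually_mono)
    then show "amalgam_norm A B f = amalgam_norm A B g"
      unfolding amalgam_norm_def using fg emod_in_Mpos by (intro antisym mono_AE) auto
  next
    fix f show "amalgam_norm A B (emb (\<lambda>x. emod (f x))) = amalgam_norm A B f"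
      by (simp add: amalgam_norm_def emb_def)
  next
    fix f :: "real \<Rightarrow> ennreal" and a :: real assume "f \<in> Mpos" "0 \<le> a"
    then show "amalgam_norm A B (emb (\<lambda>x. ennreal a * f x)) = ennreal a * amalgam_norm A B (emb f)"
      by (simp add: A.loc_norm_scale B.glob_norm_scale distrib_left)
  next
    fix f assume f: "f \<in> Mpos"
    show "amalgam_norm A B (emb f) = 0 \<longleftrightarrow> (AE x in lam. f x = 0)"
    proof
      assume "amalgam_norm A B (emb f) = 0"
      then show "AE x in lam. f x = 0" using A.AE_zero_if_loc_norm_zero[OF f] by simp
    next
      assume "AE x in lam. f x = 0"
      \<comment> \<open>Zero is written as a multiple of \<open>f\<close> so that homogeneity
        evaluates both parts to 0.\<close>
      then have "loc_norm A f + glob_norm B f \<le> loc_norm A (\<lambda>x. ennreal 0 * f x) + glob_norm B (\<lambda>x. ennreal 0 * f x)"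
        using f by (intro mono_AE) (auto simp: Mpos_def elim!: eventually_mono)
      also have "\<dots> = 0" using f unfolding A.loc_norm_scale[OF f order_refl] B.glob_norm_scale[OF f order_refl] by simp
      finally show "amalgam_norm A B (emb f) = 0" by simp
    qed
  next
    fix f g assume "f \<in> Mpos" "g \<in> Mpos"
    then have "loc_norm A (\<lambda>x. f x + g x) + glob_norm B (\<lambda>x. f x + g x)
        \<le> (loc_norm A f + loc_norm A g) + (glob_norm B f + glob_norm B g)"
      by (intro add_mono A.loc_norm_triangle B.glob_norm_triangle)
    then show "amalgam_norm A B (emb (\<lambda>x. f x + g x)) \<le> amalgam_norm A B (emb f) + amalgam_norm A B (emb g)"
      by (simp add: add_ac)
  next
    fix f g assume "f \<in> Mpos" "g \<in> Mpos" "AE x in lam. f x \<le> g x"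
    then show "amalgam_norm A B (emb f) \<le> amalgam_norm A B (emb g)" by (simp add: mono_AE)
  next
    fix F :: "nat \<Rightarrow> real \<Rightarrow> ennreal" and f
    assume F: "\<And>n. F n \<in> Mpos" and f: "f \<in> Mpos"
      and ae: "AE x in lam. incseq (\<lambda>n. F n x) \<and> (\<lambda>n. F n x) \<longlonglongrightarrow> f x"
    have "AE x in lam. F n x \<le> F (Suc n) x" for n
      using ae by (rule eventually_mono) (auto simp: incseq_Suc_iff)
    then have distr_Suc: "distr (F n) s \<le> distr (F (Suc n)) s" for n s
      using F by (intro distr_AE_mono)
    have inc: "incseq (\<lambda>n. loc_norm A (F n))" "incseq (\<lambda>n. glob_norm B (F n))"
      using F distr_Suc by (intro incseq_SucI A.loc_norm_mono_distr B.glob_norm_mono_distr; blast)+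
    then have inc': "incseq (\<lambda>n. amalgam_norm A B (emb (F n)))"
      by (simp add: incseq_def add_mono)
    have "AE x in lam. F n x \<le> f x" for n
      using ae by (rule eventually_mono) (auto intro: incseq_le)
    then have "amalgam_norm A B (emb (F n)) \<le> amalgam_norm A B (emb f)" for n
      using F f by (simp add: mono_AE)
    \<comment> \<open>Both sequences of norms increase, so the supremum of the sum is the sum of the
      suprema.\<close>
    moreover have "amalgam_norm A B (emb f) \<le> (SUP n. amalgam_norm A B (emb (F n)))"
      using A.loc_norm_fatou[OF F f ae] B.glob_norm_fatou[OF F f ae] ennreal_SUP_add[OF inc]
      by (simp add: add_mono)
    ultimately have "(SUP n. amalgam_norm A B (emb (F n))) = amalgam_norm A B (emb f)"
      by (intro antisym SUP_least)
    then show "incseq (\<lambda>n. amalgam_norm A B (emb (F n)))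
        \<and> (\<lambda>n. amalgam_norm A B (emb (F n))) \<longlonglongrightarrow> amalgam_norm A B (emb f)"
      using inc' LIMSEQ_SUP[OF inc'] by simp
  next
    fix E assume E: "E \<in> sets lam" "emeasure lam E < \<infinity>"
    have "loc_norm A (indicator E) < \<infinity>"
      using A.loc_norm_le[OF indicator_in_Mpos[OF E(1)]] A.P4[OF E] by (rule le_less_trans)
    \<comment> \<open>The averages of an indicator are controlled by its integral, the measure of
      \<open>E\<close>.\<close>
    moreover have "glob_norm B (indicator E) \<le> B.cell_norm * emeasure lam E"
      using B.glob_norm_le_integral[OF indicator_in_Mpos[OF E(1)]] E(1) by simp
    then have "glob_norm B (indicator E) < \<infinity>"
      using E(2) B.cell_norm_finite by (auto intro: le_less_trans simp: ennreal_mult_less_top)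
    ultimately show "amalgam_norm A B (emb (indicator E)) < \<infinity>" by simp
  next
    fix E assume E: "E \<in> sets lam" "emeasure lam E < \<infinity>"
    then obtain M where "emeasure lam E < of_nat M" using ennreal_Ex_less_of_nat[of "emeasure lam E"] by auto
    then obtain C where C: "C < \<infinity>" "\<And>u. u \<in> Mpos \<Longrightarrow> (\<integral>\<^sup>+x\<in>E. u x \<partial>lam) \<le> C * loc_norm A u"
      using A.set_nn_integral_le_loc_norm[OF E(1), of M] less_imp_le by blast
    have "(\<integral>\<^sup>+x\<in>E. u x \<partial>lam) \<le> C * amalgam_norm A B (emb u)" if "u \<in> Mpos" for u
      using C(2)[OF that] by (rule order_trans) (simp add: mult_left_mono)
    with C(1) show "\<exists>C<\<infinity>. \<forall>f\<in>Mpos. (\<integral>\<^sup>+x\<in>E. f x \<partial>lam) \<le> C * amalgam_norm A B (emb f)" by blast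
  next
    fix f g assume fg: "f \<in> Mfun" "g \<in> Mfun" "\<forall>t\<ge>0. rearr f t = rearr g t"
    have "distr (\<lambda>x. emod (f x)) s = distr (\<lambda>x. emod (g x)) s" for s
      using fg by (rule distr_cong_rearr)
    then show "amalgam_norm A B f = amalgam_norm A B g"
      unfolding amalgam_norm_def using fg emod_in_Mpos by (intro antisym mono) auto
  qed
qed

text \<open>The local part of \<open>amalgam_norm\<close> equals the \<open>A\<close>-summand of
  \<open>WL_norm\<close>. The global part dominates the \<open>B\<close>-summand and exceeds a
  multiple of it by at most a multiple of the integral of \<open>rearr f\<close> over
  \<open>{0..1}\<close>, which \<open>P5\<close> bounds by the \<open>A\<close>-summand.\<close>

theorem corollary3p6:
  fixes A B :: "(real \<Rightarrow> ecomplex) \<Rightarrow> ennreal"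
  assumes "ri_banach_function_norm A" and "ri_banach_function_norm B"
  shows "\<exists>N. ri_banach_function_norm N \<and> equivalent_functionals (WL_norm A B) N
             \<and> WL_space A B = fspace N"
proof -
  interpret A: ri_banach_function_norm A by (rule assms)
  interpret B: ri_banach_function_norm B by (rule assms)
  obtain C where C: "C < \<infinity>" "\<And>u. u \<in> Mpos \<Longrightarrow> (\<integral>\<^sup>+x\<in>{0..1}. u x \<partial>lam) \<le> C * A (emb u)"
    using A.P5[of "{0..1}"] by (auto simp: emeasure_lam)
  \<comment> \<open>\<open>K\<close> dominates both coefficients that arise below:
    \<open>1 + B.cell_norm * C\<close> for the \<open>A\<close>-summand and 2 for the
    \<open>B\<close>-summand.\<close>
  define K where "K = 2 + enn2real (B.cell_norm * C)"
  have "B.cell_norm * C < \<infinity>" using C(1) B.cell_norm_finite by (simp add: ennreal_mult_less_top)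
  then have K: "ennreal K = 2 + B.cell_norm * C" unfolding K_def by (simp add: ennreal_plus)
  have K2: "2 \<le> K" by (simp add: K_def)
  have lower: "WL_norm A B f \<le> amalgam_norm A B f" if f: "f \<in> Mfun" for f
    unfolding WL_norm_def amalgam_norm_def A.loc_norm_eq_rearr[OF f]
    by (intro add_left_mono B.norm_rearr_tail_le[OF f])
  have upper: "amalgam_norm A B f \<le> ennreal K * WL_norm A B f" if f: "f \<in> Mfun" for f
  proof -
    let ?a = "A (emb (\<lambda>t. rearr f t * indicator {0..1} t))"
      and ?b = "B (emb (\<lambda>t. rearr f t * indicator {1<..} t))"
    have "(\<integral>\<^sup>+t\<in>{0..1}. rearr f t \<partial>lam) = (\<integral>\<^sup>+t\<in>{0..1}. (rearr f t * indicator {0..1} t) \<partial>lam)"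
      by (intro nn_integral_cong) (simp add: indicator_def)
    also have "\<dots> \<le> C * ?a"
      using rearr_in_Mpos[OF f] by (intro C(2)) simp
    finally have "glob_norm B (\<lambda>x. emod (f x)) \<le> B.cell_norm * (C * ?a) + 2 * ?b"
      by (intro order_trans[OF B.glob_norm_le_rearr[OF f]] add_right_mono mult_left_mono) auto
    then have "amalgam_norm A B f \<le> ?a + (B.cell_norm * (C * ?a) + 2 * ?b)"
      unfolding amalgam_norm_def A.loc_norm_eq_rearr[OF f] by (rule add_left_mono)
    \<comment> \<open>Terms are added until both summands carry the coefficient
      \<open>K\<close>.\<close>
    also have "\<dots> \<le> (?a + (B.cell_norm * (C * ?a) + 2 * ?b)) + (?a + B.cell_norm * C * ?b)" by simp
    also have "\<dots> = ennreal K * WL_norm A B f"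
      unfolding K WL_norm_def by (simp add: distrib_left distrib_right mult_ac add_ac mult_2)
    finally show ?thesis .
  qed
  have "equivalent_functionals (WL_norm A B) (amalgam_norm A B)"
    unfolding equivalent_functionals_def
  proof (intro exI[of _ K] conjI ballI)
    fix f assume f: "f \<in> Mfun"
    \<comment> \<open>The lower estimate holds with constant 1, so the same \<open>K\<close> serves
      for both directions.\<close>
    have "inverse K \<le> 1" using K2 by (simp add: field_simps)
    then have "ennreal (inverse K) * WL_norm A B f \<le> 1 * WL_norm A B f"
      by (intro mult_right_mono) (simp_all add: ennreal_le_1)
    then show "ennreal (inverse K) * WL_norm A B f \<le> amalgam_norm A B f"
      using lower[OF f] by simp
  qed (use K2 upper in auto)
  moreover have "WL_space A B = fspace (amalgam_norm A B)"
  proof -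
    have "WL_norm A B f < \<infinity> \<longleftrightarrow> amalgam_norm A B f < \<infinity>" if f: "f \<in> Mfun" for f
      using lower[OF f] upper[OF f] by (auto intro: le_less_trans simp: ennreal_mult_less_top)
    then show ?thesis by (auto simp: WL_space_def fspace_def)
  qed
  ultimately show ?thesis using ri_amalgam_norm[OF assms] by blast
qed

end
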